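(* Let $\omega$ be an algebraically $p$-clustering state with $p>2D$ (respectively, an exponentially $\alpha$-clustering state with $\alpha>0$). Then the form $\langle A,B\rangle_\omega:=\sum_{x\in\mathbb Z^D}\big(\omega(\iota_x(A)^*B)-\omega(A^* )\omega(B)\big)$ is an algebraically $q$-clustering form (respectively, an exponentially $\beta$-clustering form) on $\mathcal O$ with respect to $\omega$, for every $q$ with $D<q<p-D$ (respectively, every $\beta$ with $0<\beta<\alpha/2$).
   Context: Setting: Fix $D\ge1$, $\mathbb Z^D$ with $\mathrm{dist}(x,y)=\sum_i|x_i-y_i|$. $\mathcal O$ is a complex normed space with distinguished $\mathbf 1$ of norm 1, finite-dimensional subspaces $\mathcal O_X$ ($X$ finite) with $\mathcal O_\emptyset=\mathbb C\mathbf 1$, $X\subset Y\Rightarrow\mathcal O_X\subset\mathcal O_Y$, $\mathcal O_X\cap\mathcal O_Y=\mathcal O_{X\cap Y}$, $\mathcal O=\bigcup_X\mathcal O_X$; $\mathrm{supp}(A)$ smallest $X$ with $A\in\mathcal O_X$, $|A|=|\mathrm{supp}A|$, $\mathrm{dist}(A,B)$ distance of supports ($\mathrm{dist}(A,\mathbf 1)=\infty$), $\mathrm{diam}(A)$ diameter of $\mathrm{supp}A$. Completion $\mathcal A$ is a unital $C^*$-algebra, $\mathcal O_X$ are $C^*$-subalgebras, disjointly supported elements commute and their product has union support; translations $\iota_x$ are $*$-automorphisms, $\iota_x\iota_y=\iota_{x+y}$, $\mathrm{supp}(\iota_xA)=\mathrm{supp}(A)+x$. A state is a positive normalized linear functional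 on $\mathcal A$. A translation-invariant state $\omega$ is algebraically $p$-clustering ($p>D$) (resp. exponentially $\alpha$-clustering) if there exist $\nu:\mathbb N\to\mathbb R^+$ and $f:\mathbb Z\to\mathbb R^+$ with $f(d)\le d^{-p}$ (resp. $f(d)\le e^{-\alpha d}$) for all $d>0$ such that $|\omega(AB)-\omega(A)\omega(B)|\le\nu(\ell)\|A\|\|B\|f(\mathrm{dist}(A,B))$ for all $\ell$ and $A,B\in\mathcal O$ with $|A|,|B|<\ell$. A sesquilinear form $\langle\cdot,\cdot\rangle$ on $\mathcal O$ is an algebraically $q$-clustering (resp. exponentially $\beta$-clustering) form w.r.t. $\omega$ if it is translation invariant, positive semi-definite, and (I) there exist $\nu:\mathbb N\to\mathbb R^+$, $f:\mathbb Z\to\mathbb R^+$ with $f(d)\le d^{-q}$ (resp. $f(d)\le e^{-\beta d}$) for $d>0$ such that for all $\ell$ and $A,B,C\in\mathcal O$ with $|A|,|B|,|C|<\ell$: $|\langle A,BC\rangle-\langle A,B\rangle\omega(C)-\langle A,C\rangle\omega(B)|\le\nu(\ell)\|A\|\|B\|\|C\|f(\mathrm{dist}(B,C)-\mathrm{diam}(A))$; (II) for every $\ell>0$ there is $\kappa>0$ with $|\langle A,B\rangle|\le\kappa\|A\|\|B\|$ whenever $|A|,|B|<\ell$. *)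

theory Defs
  imports "HOL-Analysis.Analysis"
begin

(* The lattice Z^D is modelled as  int ^ 'd  with D = CARD('d) (>= 1 automatically),
   equipped with the l1 distance. *)

definition ldist :: "int ^ 'd \<Rightarrow> int ^ 'd \<Rightarrow> int" where
  "ldist x y = (\<Sum>i\<in>UNIV. \<bar>x $ i - y $ i\<bar>)"

(* The C*-algebra A is a type 'a which is a unital real Banach algebra (norm 1 = 1),
   with an explicitly given complex scalar multiplication scC and involution star. *)
definition cstar_alg ::
  "(complex \<Rightarrow> 'a::{real_normed_algebra_1,banach} \<Rightarrow> 'a) \<Rightarrow> ('a \<Rightarrow> 'a) \<Rightarrow> bool" where
  "cstar_alg scC star \<longleftrightarrow>
     (\<forall>r a. scC (complex_of_real r) a = scaleR r a) \<and>
     (\<forall>c a b. scC c (a + b) = scC c a + scC c b) \<and>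
     (\<forall>c d a. scC (c + d) a = scC c a + scC d a) \<and>
     (\<forall>c d a. scC (c * d) a = scC c (scC d a)) \<and>
     (\<forall>c a b. scC c (a * b) = scC c a * b \<and> scC c (a * b) = a * scC c b) \<and>
     (\<forall>c a. norm (scC c a) = cmod c * norm a) \<and>
     (\<forall>a. star (star a) = a) \<and>
     (\<forall>a b. star (a + b) = star a + star b) \<and>
     (\<forall>c a. star (scC c a) = scC (cnj c) (star a)) \<and>
     (\<forall>a b. star (a * b) = star b * star a) \<and>
     (\<forall>a. norm (star a * a) = (norm a)\<^sup>2)"

definition cspan :: "(complex \<Rightarrow> 'a \<Rightarrow> 'a) \<Rightarrow> 'a set \<Rightarrow> 'a::real_vector set" where
  "cspan scC S = {(\<Sum>b\<in>B. scC (c b) b) | B c. finite B \<and> B \<subseteq> S}"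

definition Oloc :: "((int ^ 'd) set \<Rightarrow> 'a set) \<Rightarrow> 'a set" where
  "Oloc loc = \<Union>{loc X | X. finite X}"

definition supp :: "((int ^ 'd) set \<Rightarrow> 'a set) \<Rightarrow> 'a \<Rightarrow> (int ^ 'd) set" where
  "supp loc A = (THE X. finite X \<and> A \<in> loc X \<and> (\<forall>Y. finite Y \<longrightarrow> A \<in> loc Y \<longrightarrow> X \<subseteq> Y))"

(* distance of supports; None encodes distance = infinity (some support empty) *)
definition sdist :: "((int ^ 'd) set \<Rightarrow> 'a set) \<Rightarrow> 'a \<Rightarrow> 'a \<Rightarrow> int option" where
  "sdist loc A B = (if supp loc A = {} \<or> supp loc B = {} then None
     else Some (Min {ldist x y | x y. x \<in> supp loc A \<and> y \<in> supp loc B}))"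

definition sdiam :: "((int ^ 'd) set \<Rightarrow> 'a set) \<Rightarrow> 'a \<Rightarrow> int" where
  "sdiam loc A = Max (insert 0 {ldist x y | x y. x \<in> supp loc A \<and> y \<in> supp loc A})"

(* f evaluated at a possibly infinite distance, with f(infinity) = 0 *)
definition fb :: "(int \<Rightarrow> real) \<Rightarrow> int option \<Rightarrow> real" where
  "fb f d = (case d of None \<Rightarrow> 0 | Some n \<Rightarrow> f n)"

definition quasi_local ::
  "(complex \<Rightarrow> 'a::{real_normed_algebra_1,banach} \<Rightarrow> 'a) \<Rightarrow> ('a \<Rightarrow> 'a) \<Rightarrow> ((int ^ 'd) set \<Rightarrow> 'a set)
    \<Rightarrow> (int ^ 'd \<Rightarrow> 'a \<Rightarrow> 'a) \<Rightarrow> bool" where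
  "quasi_local scC star loc iota \<longleftrightarrow>
     cstar_alg scC star \<and>
     (\<forall>X. finite X \<longrightarrow> (\<exists>F. finite F \<and> loc X = cspan scC F)) \<and>
     (\<forall>X. finite X \<longrightarrow> (\<forall>a\<in>loc X. \<forall>b\<in>loc X. a * b \<in> loc X \<and> star a \<in> loc X)) \<and>
     loc {} = range (\<lambda>c. scC c 1) \<and>
     (\<forall>X Y. finite Y \<longrightarrow> X \<subseteq> Y \<longrightarrow> loc X \<subseteq> loc Y) \<and>
     (\<forall>X Y. finite X \<longrightarrow> finite Y \<longrightarrow> loc X \<inter> loc Y = loc (X \<inter> Y)) \<and>
     closure (Oloc loc) = UNIV \<and>
     (\<forall>A\<in>Oloc loc. \<forall>B\<in>Oloc loc. supp loc A \<inter> supp loc B = {} \<longrightarrow>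
        A * B = B * A \<and>
        (A \<noteq> 0 \<longrightarrow> B \<noteq> 0 \<longrightarrow> supp loc (A * B) = supp loc A \<union> supp loc B)) \<and>
     (\<forall>x. bij (iota x) \<and> iota x 1 = 1 \<and>
        (\<forall>a b. iota x (a + b) = iota x a + iota x b) \<and>
        (\<forall>a b. iota x (a * b) = iota x a * iota x b) \<and>
        (\<forall>c a. iota x (scC c a) = scC c (iota x a)) \<and>
        (\<forall>a. iota x (star a) = star (iota x a))) \<and>
     (\<forall>x y. iota x \<circ> iota y = iota (x + y)) \<and>
     (\<forall>x. \<forall>A\<in>Oloc loc. iota x A \<in> Oloc loc \<and>
        supp loc (iota x A) = (\<lambda>z. z + x) ` supp loc A)"

definition is_state :: "(complex \<Rightarrow> 'a \<Rightarrow> 'a) \<Rightarrow> ('a \<Rightarrow> 'a) \<Rightarrow> ('a::ring_1 \<Rightarrow> complex) \<Rightarrow> bool" where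
  "is_state scC star \<omega> \<longleftrightarrow>
     (\<forall>a b. \<omega> (a + b) = \<omega> a + \<omega> b) \<and> (\<forall>c a. \<omega> (scC c a) = c * \<omega> a) \<and>
     \<omega> 1 = 1 \<and> (\<forall>a. Im (\<omega> (star a * a)) = 0 \<and> Re (\<omega> (star a * a)) \<ge> 0)"

definition clustering_state ::
  "(complex \<Rightarrow> 'a \<Rightarrow> 'a) \<Rightarrow> ('a \<Rightarrow> 'a) \<Rightarrow> ((int ^ 'd) set \<Rightarrow> 'a set)
    \<Rightarrow> (int ^ 'd \<Rightarrow> 'a \<Rightarrow> 'a) \<Rightarrow> (int \<Rightarrow> real) \<Rightarrow> ('a::real_normed_algebra_1 \<Rightarrow> complex) \<Rightarrow> bool" where
  "clustering_state scC star loc iota g \<omega> \<longleftrightarrow>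
     is_state scC star \<omega> \<and> (\<forall>x a. \<omega> (iota x a) = \<omega> a) \<and>
     (\<exists>(\<nu>::nat \<Rightarrow> real) (f::int \<Rightarrow> real). (\<forall>n. \<nu> n \<ge> 0) \<and> (\<forall>d. f d \<ge> 0) \<and>
        (\<forall>d>0. f d \<le> g d) \<and>
        (\<forall>l A B. A \<in> Oloc loc \<longrightarrow> B \<in> Oloc loc \<longrightarrow>
           card (supp loc A) < l \<longrightarrow> card (supp loc B) < l \<longrightarrow>
           cmod (\<omega> (A * B) - \<omega> A * \<omega> B) \<le> \<nu> l * norm A * norm B * fb f (sdist loc A B)))"

definition alg_clustering_state where
  "alg_clustering_state scC star loc iota (p::real) \<omega> \<longleftrightarrow>
     p > real CARD('d) \<and>
     clustering_state scC star (loc :: (int ^ 'd) set \<Rightarrow> _) iota (\<lambda>d. real_of_int d powr (- p)) \<omega>"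

definition exp_clustering_state where
  "exp_clustering_state scC star loc iota (\<alpha>::real) \<omega> \<longleftrightarrow>
     clustering_state scC star loc iota (\<lambda>d. exp (- \<alpha> * real_of_int d)) \<omega>"

definition clustering_form ::
  "(complex \<Rightarrow> 'a \<Rightarrow> 'a) \<Rightarrow> ('a \<Rightarrow> 'a) \<Rightarrow> ((int ^ 'd) set \<Rightarrow> 'a set)
    \<Rightarrow> (int ^ 'd \<Rightarrow> 'a \<Rightarrow> 'a) \<Rightarrow> (int \<Rightarrow> real) \<Rightarrow> ('a::real_normed_algebra_1 \<Rightarrow> complex)
    \<Rightarrow> ('a \<Rightarrow> 'a \<Rightarrow> complex) \<Rightarrow> bool" where
  "clustering_form scC star loc iota g \<omega> F \<longleftrightarrow>
     (\<forall>A\<in>Oloc loc. \<forall>B\<in>Oloc loc. \<forall>C\<in>Oloc loc. \<forall>c.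
        F A (B + C) = F A B + F A C \<and> F (A + B) C = F A C + F B C \<and>
        F A (scC c B) = c * F A B \<and> F (scC c A) B = cnj c * F A B) \<and>
     (\<forall>x. \<forall>A\<in>Oloc loc. \<forall>B\<in>Oloc loc. F (iota x A) (iota x B) = F A B) \<and>
     (\<forall>A\<in>Oloc loc. Im (F A A) = 0 \<and> Re (F A A) \<ge> 0) \<and>
     (\<exists>(\<nu>::nat \<Rightarrow> real) (f::int \<Rightarrow> real). (\<forall>n. \<nu> n \<ge> 0) \<and> (\<forall>d. f d \<ge> 0) \<and>
        (\<forall>d>0. f d \<le> g d) \<and>
        (\<forall>l A B C. A \<in> Oloc loc \<longrightarrow> B \<in> Oloc loc \<longrightarrow> C \<in> Oloc loc \<longrightarrow>
           card (supp loc A) < l \<longrightarrow> card (supp loc B) < l \<longrightarrow> card (supp loc C) < l \<longrightarrow>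
           cmod (F A (B * C) - F A B * \<omega> C - F A C * \<omega> B)
             \<le> \<nu> l * norm A * norm B * norm C *
                fb f (map_option (\<lambda>d. d - sdiam loc A) (sdist loc B C)))) \<and>
     (\<forall>l::nat. l > 0 \<longrightarrow> (\<exists>\<kappa>>0. \<forall>A\<in>Oloc loc. \<forall>B\<in>Oloc loc.
        card (supp loc A) < l \<longrightarrow> card (supp loc B) < l \<longrightarrow>
        cmod (F A B) \<le> \<kappa> * norm A * norm B))"

definition alg_clustering_form where
  "alg_clustering_form scC star loc iota (q::real) \<omega> F \<longleftrightarrow>
     clustering_form scC star (loc :: (int ^ 'd) set \<Rightarrow> _) iota (\<lambda>d. real_of_int d powr (- q)) \<omega> F"

definition exp_clustering_form where
  "exp_clustering_form scC star loc iota (\<beta>::real) \<omega> F \<longleftrightarrow>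
     clustering_form scC star loc iota (\<lambda>d. exp (- \<beta> * real_of_int d)) \<omega> F"

definition corr_term :: "('a \<Rightarrow> 'a) \<Rightarrow> (int ^ 'd \<Rightarrow> 'a \<Rightarrow> 'a) \<Rightarrow> ('a::ring \<Rightarrow> complex)
    \<Rightarrow> 'a \<Rightarrow> 'a \<Rightarrow> int ^ 'd \<Rightarrow> complex" where
  "corr_term star iota \<omega> A B x = \<omega> (star (iota x A) * B) - \<omega> (star A) * \<omega> B"

definition omega_form :: "('a \<Rightarrow> 'a) \<Rightarrow> (int ^ 'd \<Rightarrow> 'a \<Rightarrow> 'a) \<Rightarrow> ('a::ring \<Rightarrow> complex)
    \<Rightarrow> 'a \<Rightarrow> 'a \<Rightarrow> complex" where
  "omega_form star iota \<omega> A B = (\<Sum>\<^sub>\<infinity>x\<in>UNIV. corr_term star iota \<omega> A B x)"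

end

theory Submission
  imports Defs
begin

text \<open>
  Clustering makes the terms of the form decay in the distance between the translate \<open>A\<^sub>x\<close>
  of \<open>A\<close> and \<open>B\<close>, hence summable. Positivity holds because \<open>x \<mapsto> \<omega>(A\<^sub>x\<^sup>* A) - |\<omega>(A)|\<^sup>2\<close> is a positive
  definite function on the lattice, whose sum is the limit of the variances of \<open>\<Sum>\<^sub>x A\<^sub>x\<close> over
  large boxes divided by the volume.

  For the Leibniz-type estimate (I), consider the defect for a single \<open>x\<close>. On the one hand each of its
  three terms decays in the distance \<open>m\<close> of \<open>A\<^sub>x\<close> to the supports of \<open>B\<close> and \<open>C\<close>. On the other hand, by the
  triangle inequality \<open>A\<^sub>x\<close> has distance at least \<open>e/2\<close> from \<open>B\<close> or from \<open>C\<close>, where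
  \<open>e = dist(B, C) - diam(A)\<close>; regrouping the terms bounds the defect by the decay at \<open>e/2\<close>.
  A weighted geometric mean of the two bounds is summable in \<open>x\<close> and leaves any power below
  \<open>p - D\<close>, respectively any exponential rate below \<open>\<alpha>/2\<close>.
\<close>

section \<open>Finite-dimensional subspaces: closedness and bounded linear maps\<close>

lemma span_insert_cases:
  assumes "x \<in> span (insert b B)"
  obtains t y where "y \<in> span B" "x = y + t *\<^sub>R b"
  using assms by (metis add.commute diff_add_cancel span_breakdown_eq)

text \<open>Some ball of radius \<open>d\<close> around \<open>b\<close> misses the closed span, and
  rescaling by \<open>1/t\<close> turns this into control of the coefficient of \<open>b\<close>.
  The two inductions below rest on it.\<close>

lemma closed_span_coefficient_bound:
  fixes B :: "'a::real_normed_vector set"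
  assumes "closed (span B)" "b \<notin> span B"
  obtains d where "d > 0" "\<And>y t. y \<in> span B \<Longrightarrow> \<bar>t\<bar> * d \<le> norm (y + t *\<^sub>R b)"
proof -
  have "open (- span B)" using assms by auto
  then obtain d where d: "d > 0" "ball b d \<subseteq> - span B"
    using assms by (meson ComplI open_contains_ball)
  have "\<bar>t\<bar> * d \<le> norm (y + t *\<^sub>R b)" if "y \<in> span B" for y t
  proof (cases "t = 0")
    case False
    have "(- (1/t)) *\<^sub>R y \<in> span B" using that span_mul by blast
    then have "d \<le> dist ((- (1/t)) *\<^sub>R y) b"
      using d(2) by (metis ComplD dist_commute in_mono mem_ball not_le)
    also have "\<dots> = norm (- ((- (1/t)) *\<^sub>R y - b))" by (simp only: dist_norm norm_minus_cancel)
    also have "- ((- (1/t)) *\<^sub>R y - b) = (1/t) *\<^sub>R (y + t *\<^sub>R b)"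
      using False by (simp add: scaleR_right_distrib)
    also have "norm \<dots> = norm (y + t *\<^sub>R b) / \<bar>t\<bar>" by simp
    finally show ?thesis using False by (simp add: field_simps)
  qed auto
  then show ?thesis using that d(1) by blast
qed

text \<open>Along a convergent sequence in the enlarged span, the coefficients of the new vector are
  Cauchy by the coefficient bound. Subtracting that component leaves a convergent sequence in the
  smaller span, which is closed by induction.\<close>

lemma closed_span_finite:
  fixes B :: "'a::real_normed_vector set"
  assumes "finite B"
  shows "closed (span B)"
  using assms
proof (induction rule: finite_induct)
  case empty
  then show ?case by simp
next
  case (insert b B)
  show ?case
  proof (cases "b \<in> span B")
    case True
    then show ?thesis using insert by (simp add: span_redundant)
  next
    case False
    obtain d where d: "d > 0" and coef: "\<And>y t. y \<in> span B \<Longrightarrow> \<bar>t\<bar> * d \<le> norm (y + t *\<^sub>R b)"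
      using closed_span_coefficient_bound[OF insert.IH False] by blast
    show ?thesis
      unfolding closed_sequential_limits
    proof (intro allI impI, elim conjE)
      fix v :: "nat \<Rightarrow> 'a" and l
      assume v: "\<forall>n. v n \<in> span (insert b B)" and l: "v \<longlonglongrightarrow> l"
      have "\<forall>n. \<exists>t y. y \<in> span B \<and> v n = y + t *\<^sub>R b"
        using v span_insert_cases by metis
      then obtain t y where ty: "\<And>n. y n \<in> span B" "\<And>n. v n = y n + t n *\<^sub>R b"
        by metis
      have tb: "\<bar>t m - t n\<bar> * d \<le> norm (v m - v n)" for m n
        using coef[of "y m - y n" "t m - t n"] ty
        by (simp add: span_diff algebra_simps)
      have "Cauchy t"
      proof (rule metric_CauchyI)
        fix e :: real assume "e > 0"
        have "Cauchy v" using l LIMSEQ_imp_Cauchy by blast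
        then obtain M where M: "\<forall>m\<ge>M. \<forall>n\<ge>M. dist (v m) (v n) < e * d"
          using d \<open>e > 0\<close> unfolding Cauchy_def by (meson mult_pos_pos)
        have "dist (t m) (t n) < e" if "m \<ge> M" "n \<ge> M" for m n
        proof -
          have "\<bar>t m - t n\<bar> * d < e * d" using tb[of m n] M that by (smt (verit) dist_norm)
          then show ?thesis using d by (simp add: dist_real_def)
        qed
        then show "\<exists>M. \<forall>m\<ge>M. \<forall>n\<ge>M. dist (t m) (t n) < e" by blast
      qed
      then obtain s where s: "t \<longlonglongrightarrow> s" using Cauchy_convergent convergent_def by blast
      have lim: "(\<lambda>n. v n - t n *\<^sub>R b) \<longlonglongrightarrow> l - s *\<^sub>R b"
        by (intro tendsto_intros l s)
      have "l - s *\<^sub>R b \<in> span B"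
        by (rule closed_sequentially[OF insert.IH _ lim]) (use ty in simp)
      then show "l \<in> span (insert b B)" using span_breakdown_eq by blast
    qed
  qed
qed

lemma linear_bounded_on_finite_span:
  fixes B :: "'a::real_normed_vector set" and f :: "'a \<Rightarrow> 'b::real_normed_vector"
  assumes "finite B" and f: "linear f"
  shows "\<exists>K. \<forall>x\<in>span B. norm (f x) \<le> K * norm x"
  using assms(1)
proof (induction rule: finite_induct)
  case empty
  then show ?case using linear_0[OF f] by simp
next
  case (insert b B)
  show ?case
  proof (cases "b \<in> span B")
    case True
    then show ?thesis using insert by (simp add: span_redundant)
  next
    case False
    obtain K where K: "\<And>x. x \<in> span B \<Longrightarrow> norm (f x) \<le> K * norm x" using insert by blast
    obtain d where d: "d > 0" and coef: "\<And>y t. y \<in> span B \<Longrightarrow> \<bar>t\<bar> * d \<le> norm (y + t *\<^sub>R b)"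
      using closed_span_coefficient_bound[OF closed_span_finite[OF insert.hyps(1)] False] by blast
    \<comment> \<open>\<open>M\<close> adds the bound for the component in \<open>span B\<close> and
      the one for the coefficient of \<open>b\<close>. The absolute value is there because
      \<open>K\<close> may be negative when \<open>span B\<close> is trivial.\<close>
    define M where "M = \<bar>K\<bar> * (1 + norm b / d) + norm (f b) / d"
    have "norm (f x) \<le> M * norm x" if x: "x \<in> span (insert b B)" for x
    proof -
      obtain t y where y: "y \<in> span B" "x = y + t *\<^sub>R b" using x by (rule span_insert_cases)
      have t: "\<bar>t\<bar> \<le> norm x / d" using coef[OF y(1), of t] d y(2) by (simp add: field_simps)
      have "norm y = norm (x - t *\<^sub>R b)" using y by simp
      also have "\<dots> \<le> norm x + \<bar>t\<bar> * norm b" by (metis norm_scaleR norm_triangle_ineq4)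
      also have "\<dots> \<le> norm x + norm x / d * norm b" by (intro add_mono mult_right_mono t order_refl norm_ge_zero)
      finally have ny: "norm y \<le> norm x + norm x / d * norm b" .
      have "norm (f x) \<le> norm (f y) + \<bar>t\<bar> * norm (f b)"
        unfolding y(2) linear_add[OF f] linear_cmul[OF f] by (metis norm_scaleR norm_triangle_ineq)
      also have "\<dots> \<le> \<bar>K\<bar> * norm y + norm x / d * norm (f b)"
      proof (intro add_mono mult_right_mono t)
        have "norm (f y) \<le> K * norm y" using K y by blast
        also have "\<dots> \<le> \<bar>K\<bar> * norm y" by (simp add: mult_right_mono)
        finally show "norm (f y) \<le> \<bar>K\<bar> * norm y" .
      qed simp
      also have "\<dots> \<le> \<bar>K\<bar> * (norm x + norm x / d * norm b) + norm x / d * norm (f b)"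
        using ny by (simp add: mult_left_mono)
      also have "\<dots> = M * norm x" by (simp add: M_def field_simps)
      finally show ?thesis .
    qed
    then show ?thesis by blast
  qed
qed

lemma le_if_dyadic_powers_le:
  fixes x y M :: real
  assumes "0 \<le> x" "0 \<le> y" and le: "\<And>n::nat. x ^ (2 ^ n) \<le> M * y ^ (2 ^ n)"
  shows "x \<le> y"
proof (rule ccontr)
  assume "\<not> x \<le> y"
  then have xy: "y < x" by simp
  show False
  proof (cases "y = 0")
    case True
    then show ?thesis using le[of 0] xy by simp
  next
    case False
    then have y: "y > 0" using assms by simp
    have "x / y > 1" using xy y by simp
    then obtain k where k: "M < (x / y) ^ k" using real_arch_pow by blast
    also have "\<dots> \<le> (x / y) ^ (2 ^ k)"
      using \<open>x / y > 1\<close> by (intro power_increasing) (auto intro: less_imp_le)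
    also have "\<dots> \<le> M" using le[of k] y by (simp add: power_divide field_simps)
    finally show False by simp
  qed
qed

section \<open>Summability over the lattice\<close>

text \<open>The coordinates of finitely many points lie in a finite \<open>J\<close>. Over the
  product set the sum factorises into a power of a one-dimensional sum, which bounds all partial
  sums.\<close>

lemma summable_on_vec_prod:
  fixes \<phi> :: "int \<Rightarrow> real"
  assumes \<phi>: "\<phi> summable_on UNIV" "\<And>k. \<phi> k \<ge> 0"
  shows "(\<lambda>x::int^'d. \<Prod>i\<in>UNIV. \<phi> (x $ i)) summable_on UNIV"
proof (rule nonneg_bdd_above_summable_on)
  show "0 \<le> (\<Prod>i\<in>UNIV. \<phi> ((x::int^'d) $ i))" for x by (simp add: prod_nonneg \<phi>)
  have "sum (\<lambda>x::int^'d. \<Prod>i\<in>UNIV. \<phi> (x $ i)) F \<le> infsum \<phi> UNIV ^ CARD('d)"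
    if F: "finite F" for F :: "(int^'d) set"
  proof -
    define J where "J = (\<Union>x\<in>F. range (($) x))"
    have J: "finite J" unfolding J_def using F by auto
    have "sum (\<lambda>x::int^'d. \<Prod>i\<in>UNIV. \<phi> (x $ i)) F = sum (\<lambda>g. \<Prod>i\<in>UNIV. \<phi> (g i)) (($) ` F)"
      by (subst sum.reindex) (auto simp: inj_on_def vec_nth_inject)
    also have "\<dots> \<le> sum (\<lambda>g. \<Prod>i\<in>UNIV. \<phi> (g i)) (PiE UNIV (\<lambda>_::'d. J))"
    proof (rule sum_mono2)
      show "finite (PiE UNIV (\<lambda>_::'d. J))" by (simp add: J finite_PiE)
    qed (auto simp: J_def prod_nonneg \<phi>)
    also have "\<dots> = (\<Prod>i\<in>(UNIV::'d set). \<Sum>k\<in>J. \<phi> k)"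
      by (subst prod_sum_PiE) (auto simp: J)
    also have "\<dots> = (\<Sum>k\<in>J. \<phi> k) ^ CARD('d)" by simp
    also have "\<dots> \<le> infsum \<phi> UNIV ^ CARD('d)"
      by (intro power_mono finite_sum_le_infsum sum_nonneg) (auto simp: \<phi> J)
    finally show ?thesis .
  qed
  then show "bdd_above (sum (\<lambda>x::int^'d. \<Prod>i\<in>UNIV. \<phi> (x $ i)) ` {F. F \<subseteq> UNIV \<and> finite F})"
    by (intro bdd_aboveI2) auto
qed

lemma summable_on_int_even:
  fixes \<phi> :: "nat \<Rightarrow> real"
  assumes "summable \<phi>" "\<And>n. \<phi> n \<ge> 0"
  shows "(\<lambda>k::int. \<phi> (nat \<bar>k\<bar>)) summable_on UNIV"
proof -
  have s: "\<phi> summable_on UNIV" using assms by (simp add: norm_summable_imp_summable_on)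
  have "(\<lambda>k::int. \<phi> (nat \<bar>k\<bar>)) summable_on (range int)"
    using s by (subst summable_on_reindex) (auto simp: o_def)
  moreover have "(\<lambda>k::int. \<phi> (nat \<bar>k\<bar>)) summable_on (range (\<lambda>n. - int n))"
    using s by (subst summable_on_reindex) (auto simp: o_def inj_on_def)
  ultimately have "(\<lambda>k::int. \<phi> (nat \<bar>k\<bar>)) summable_on (range int \<union> range (\<lambda>n. - int n))"
    by (rule summable_on_union)
  moreover have "range int \<union> range (\<lambda>n. - int n) = UNIV"
    by (metis (no_types, lifting) UNIV_eq_I UnCI int_cases2 rangeI)
  ultimately show ?thesis by simp
qed

lemma ldist_nonneg: "0 \<le> ldist x y"
  by (simp add: ldist_def sum_nonneg)

lemma ldist_commute: "ldist x y = ldist y x"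
  by (simp add: ldist_def abs_minus_commute)

lemma ldist_triangle: "ldist x z \<le> ldist x y + ldist y z"
  unfolding ldist_def sum.distrib[symmetric] by (rule sum_mono) linarith

lemma ldist_eq_0_iff: "ldist x y = 0 \<longleftrightarrow> x = y"
  by (auto simp: ldist_def sum_nonneg_eq_0_iff vec_eq_iff)

text \<open>Every coordinate is bounded by the distance to 0, so spreading the exponent evenly over
  the coordinates gives a product of one-dimensional factors whose exponent \<open>c\<close> exceeds
  1.\<close>

lemma summable_on_vec_powr:
  assumes "s > real CARD('d)"
  shows "(\<lambda>x::int^'d. (1 + real_of_int (ldist x 0)) powr (- s)) summable_on UNIV"
proof -
  define c where "c = s / real CARD('d)"
  have c: "c > 1" using assms by (simp add: c_def field_simps)
  define \<phi> where "\<phi> = (\<lambda>n::nat. (1 + real n) powr (- c))"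
  have "summable (\<lambda>n. real (Suc n) powr (- c))"
    using c by (subst summable_Suc_iff) (simp add: summable_real_powr_iff)
  then have "summable \<phi>" by (simp add: \<phi>_def add.commute)
  then have "(\<lambda>k::int. \<phi> (nat \<bar>k\<bar>)) summable_on UNIV"
    by (rule summable_on_int_even) (simp add: \<phi>_def)
  then have sp: "(\<lambda>x::int^'d. \<Prod>i\<in>UNIV. \<phi> (nat \<bar>x $ i\<bar>)) summable_on UNIV"
    by (rule summable_on_vec_prod) (simp add: \<phi>_def)
  show ?thesis
  proof (rule summable_on_comparison_test[OF sp])
    fix x :: "int^'d"
    have "(1 + real_of_int (ldist x 0)) powr (- s) = (\<Prod>i\<in>(UNIV::'d set). (1 + real_of_int (ldist x 0)) powr (- c))"
      using ldist_nonneg[of x 0]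
      by (simp add: powr_realpow[symmetric] powr_powr c_def)
    also have "\<dots> \<le> (\<Prod>i\<in>UNIV. \<phi> (nat \<bar>x $ i\<bar>))"
    proof (rule prod_mono, safe)
      fix i
      have "\<bar>x $ i\<bar> \<le> ldist x 0"
        unfolding ldist_def using member_le_sum[of i UNIV "\<lambda>i. \<bar>x $ i - 0 $ i\<bar>"] by simp
      then show "(1 + real_of_int (ldist x 0)) powr (- c) \<le> \<phi> (nat \<bar>x $ i\<bar>)"
        unfolding \<phi>_def using c by (intro powr_mono2') auto
    qed simp
    finally show "(1 + real_of_int (ldist x 0)) powr (- s) \<le> (\<Prod>i\<in>UNIV. \<phi> (nat \<bar>x $ i\<bar>))" .
  qed simp
qed

text \<open>For the l1 distance the exponential is exactly a product of geometric terms over the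
  coordinates.\<close>

lemma summable_on_vec_exp:
  assumes "s > 0"
  shows "(\<lambda>x::int^'d. exp (- s * real_of_int (ldist x 0))) summable_on UNIV"
proof -
  define \<phi> where "\<phi> = (\<lambda>n::nat. exp (- s) ^ n)"
  have "summable \<phi>" unfolding \<phi>_def using assms by (intro summable_geometric) simp
  then have "(\<lambda>k::int. \<phi> (nat \<bar>k\<bar>)) summable_on UNIV"
    by (rule summable_on_int_even) (simp add: \<phi>_def)
  then have "(\<lambda>x::int^'d. \<Prod>i\<in>UNIV. \<phi> (nat \<bar>x $ i\<bar>)) summable_on UNIV"
    by (rule summable_on_vec_prod) (simp add: \<phi>_def)
  moreover have "(\<Prod>i\<in>UNIV. \<phi> (nat \<bar>x $ i\<bar>)) = exp (- s * real_of_int (ldist x 0))" for x :: "int^'d"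
  proof -
    have "\<phi> (nat \<bar>x $ i\<bar>) = exp (- s * real_of_int \<bar>x $ i\<bar>)" for i
      unfolding \<phi>_def exp_of_nat_mult[symmetric] by (simp add: mult.commute)
    then show ?thesis by (simp add: ldist_def sum_distrib_left flip: sum_negf exp_sum)
  qed
  ultimately show ?thesis by simp
qed

section \<open>Averaging positive definite functions over boxes\<close>

text \<open>Cubes are the averaging regions: their cardinality is an exact power, so widening the
  side by a constant changes the volume by a factor tending to 1.\<close>

definition lbox :: "nat \<Rightarrow> (int ^ 'd) set" where
  "lbox n = {x. \<forall>i. \<bar>x $ i\<bar> \<le> int n}"

lemma lbox_eq_image: "(lbox n :: (int^'d) set) = vec_lambda ` (PiE UNIV (\<lambda>_. {- int n..int n}))"
proof (intro equalityI subsetI)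
  fix x :: "int^'d" assume "x \<in> lbox n"
  then have "- int n \<le> x $ i \<and> x $ i \<le> int n" for i by (simp add: lbox_def abs_le_iff minus_le_iff)
  then have "(\<lambda>i. x $ i) \<in> (PiE UNIV (\<lambda>_. {- int n..int n}))" by (simp add: PiE_UNIV_domain)
  then show "x \<in> vec_lambda ` (PiE UNIV (\<lambda>_. {- int n..int n}))"
    by (rule rev_image_eqI) simp
next
  fix x :: "int^'d" assume "x \<in> vec_lambda ` (PiE UNIV (\<lambda>_. {- int n..int n}))"
  then obtain g where g: "g \<in> PiE UNIV (\<lambda>_::'d. {- int n..int n})" and x: "x = vec_lambda g" by (rule imageE)
  show "x \<in> lbox n" using PiE_mem[OF g] by (simp add: x lbox_def abs_le_iff minus_le_iff)
qed

lemma finite_lbox: "finite (lbox n)"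
  unfolding lbox_eq_image by (intro finite_imageI finite_PiE) auto

lemma card_lbox: "card (lbox n :: (int^'d) set) = (2 * n + 1) ^ CARD('d)"
proof -
  have "card (lbox n :: (int^'d) set) = card (PiE (UNIV::'d set) (\<lambda>_. {- int n..int n}))"
    unfolding lbox_eq_image by (rule card_image) (auto simp: inj_on_def vec_lambda_inject)
  also have "\<dots> = (2 * n + 1) ^ CARD('d)"
    by (simp add: card_PiE nat_add_distrib nat_mult_distrib)
  finally show ?thesis .
qed

lemma lbox_mono: "m \<le> n \<Longrightarrow> lbox m \<subseteq> (lbox n :: (int^'d) set)"
proof
  fix x :: "int^'d" assume mn: "m \<le> n" and "x \<in> lbox m"
  then have "\<bar>x $ i\<bar> \<le> int m" for i by (simp add: lbox_def)
  then have "\<bar>x $ i\<bar> \<le> int n" for i using mn by (meson of_nat_le_iff order_trans)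
  then show "x \<in> lbox n" by (simp add: lbox_def)
qed

lemma finite_subset_lbox:
  fixes Z :: "(int^'d) set"
  assumes "finite Z"
  obtains n where "Z \<subseteq> lbox n"
proof -
  \<comment> \<open>A crude radius: the sum of all absolute coordinates bounds each of them, and it
    also makes sense for empty \<open>Z\<close>.\<close>
  define n where "n = (\<Sum>z\<in>Z. \<Sum>i\<in>UNIV. nat \<bar>z $ i\<bar>)"
  have "\<bar>z $ i\<bar> \<le> int n" if "z \<in> Z" for z i
  proof -
    have "nat \<bar>z $ i\<bar> \<le> (\<Sum>i\<in>UNIV. nat \<bar>z $ i\<bar>)"
      by (rule member_le_sum) auto
    also have "\<dots> \<le> n" unfolding n_def
      by (rule member_le_sum[of z Z "\<lambda>z. \<Sum>i\<in>UNIV. nat \<bar>z $ i\<bar>"]) (auto simp: assms that)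
    finally show ?thesis by simp
  qed
  then show ?thesis using that[of n] by (auto simp: lbox_def)
qed

text \<open>Averaging over boxes: the points within a fixed distance of the boundary of a large
  box are negligible, and every other point sees almost the whole sum.\<close>

lemma infsum_nonneg_of_positive_definite:
  fixes t :: "int^'d \<Rightarrow> real"
  assumes t: "t summable_on UNIV"
    and pd: "\<And>\<Lambda>. finite \<Lambda> \<Longrightarrow> 0 \<le> (\<Sum>x\<in>\<Lambda>. \<Sum>y\<in>\<Lambda>. t (x - y))"
  shows "0 \<le> infsum t UNIV"
proof (rule ccontr)
  define S where "S = infsum t UNIV"
  assume "\<not> 0 \<le> infsum t UNIV"
  then have S: "S < 0" by (simp add: S_def)
  have at: "(\<lambda>x. \<bar>t x\<bar>) summable_on UNIV"
    using summable_on_iff_abs_summable_on_real[THEN iffD1, OF t] by (simp only: real_norm_def)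
  define N where "N = infsum (\<lambda>x. \<bar>t x\<bar>) UNIV"
  have "(t has_sum S) UNIV" using t by (simp add: S_def)
  then have "\<forall>\<^sub>F F in finite_subsets_at_top UNIV. sum t F < S / 2"
    unfolding has_sum_def by (rule order_tendstoD) (use S in simp)
  \<comment> \<open>Since \<open>S\<close> is negative, \<open>S / 2\<close> leaves room: all finite
    sums over sets containing \<open>Z\<close> stay below one fixed negative number.\<close>
  then obtain Z where Z: "finite Z" "\<And>W. finite W \<Longrightarrow> Z \<subseteq> W \<Longrightarrow> sum t W < S / 2"
    unfolding eventually_finite_subsets_at_top by auto
  obtain R where R: "Z \<subseteq> lbox R" using finite_subset_lbox[OF Z(1)] .
  have shift: "(\<Sum>y\<in>\<Lambda>. t (x - y)) = sum t ((\<lambda>y. x - y) ` \<Lambda>)" for x \<Lambda>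
    by (subst sum.reindex) (auto simp: inj_on_def)
  \<comment> \<open>For \<open>x\<close> in the inner box, the reflected outer box around
    \<open>x\<close> still contains \<open>lbox R\<close>, hence \<open>Z\<close>, so the whole row
    sums to at most \<open>S / 2\<close>.\<close>
  have inner: "(\<Sum>y\<in>lbox (n + R). t (x - y)) \<le> S / 2" if x: "x \<in> lbox n" for n x
  proof -
    have "Z \<subseteq> (\<lambda>y. x - y) ` lbox (n + R)"
    proof
      fix z assume "z \<in> Z"
      then have "\<bar>z $ i\<bar> \<le> int R" for i using R by (auto simp: lbox_def)
      moreover have "\<bar>x $ i\<bar> \<le> int n" for i using x by (auto simp: lbox_def)
      ultimately have "\<bar>x $ i\<bar> + \<bar>z $ i\<bar> \<le> int n + int R" for i by (simp add: add_mono)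
      then have "\<bar>x $ i - z $ i\<bar> \<le> int (n + R)" for i
        using order_trans[OF abs_triangle_ineq4[of "x $ i" "z $ i"]] by simp
      then have "\<bar>(x - z) $ i\<bar> \<le> int (n + R)" for i
        by (simp only: vector_minus_component)
      then have "x - z \<in> lbox (n + R)" by (simp add: lbox_def)
      then show "z \<in> (\<lambda>y. x - y) ` lbox (n + R)" by (intro image_eqI[of _ _ "x - z"]) auto
    qed
    then have "sum t ((\<lambda>y. x - y) ` lbox (n + R)) < S / 2" by (intro Z(2) finite_imageI finite_lbox)
    then show ?thesis using shift[of x "lbox (n + R)"] by linarith
  qed
  \<comment> \<open>Rows belonging to points near the boundary only get the crude bound by the
    absolute sum.\<close>
  have outer: "(\<Sum>y\<in>\<Lambda>. t (x - y)) \<le> N" if "finite \<Lambda>" for x \<Lambda>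
  proof -
    have "sum t ((\<lambda>y. x - y) ` \<Lambda>) \<le> (\<Sum>z\<in>(\<lambda>y. x - y) ` \<Lambda>. \<bar>t z\<bar>)" by (rule sum_mono) simp
    also have "\<dots> \<le> N" unfolding N_def using at that by (intro finite_sum_le_infsum) auto
    finally show ?thesis using shift[of x \<Lambda>] by linarith
  qed
  define v where "v = (\<lambda>n::nat. (2 * real n + 1) ^ CARD('d))"
  have v: "real (card (lbox n :: (int^'d) set)) = v n" for n
    by (simp add: card_lbox v_def add.commute)
  \<comment> \<open>The double sum over the outer box splits into the rows of the inner box and
    those of the boundary layer, whose number of points is the difference of the two
    volumes.\<close>
  have key: "0 \<le> v n * (S / 2) + (v (n + R) - v n) * N" for n
  proof -
    have sub: "lbox n \<subseteq> (lbox (n + R) :: (int^'d) set)" by (rule lbox_mono) simp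
    have "0 \<le> (\<Sum>x\<in>lbox (n + R). \<Sum>y\<in>lbox (n + R). t (x - y))" by (rule pd) (rule finite_lbox)
    also have "\<dots> = (\<Sum>x\<in>lbox (n + R) - lbox n. \<Sum>y\<in>lbox (n + R). t (x - y))
        + (\<Sum>x\<in>lbox n. \<Sum>y\<in>lbox (n + R). t (x - y))"
      by (rule sum.subset_diff[OF sub finite_lbox])
    also have "\<dots> \<le> real (card (lbox (n + R) - lbox n :: (int^'d) set)) * N
        + real (card (lbox n :: (int^'d) set)) * (S / 2)"
      by (intro add_mono sum_bounded_above inner outer finite_lbox)
    also have "real (card (lbox (n + R) - lbox n :: (int^'d) set)) = v (n + R) - v n"
      using sub by (simp add: card_Diff_subset finite_lbox of_nat_diff card_mono v)
    finally show ?thesis by (simp add: v)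
  qed
  have v0: "v n > 0" for n by (simp add: v_def)
  \<comment> \<open>After division by the volume, the boundary term vanishes in the limit because
    the ratio of the volumes tends to 1. What remains is \<open>- (S / 2) \<le> 0\<close>,
    contradicting \<open>S < 0\<close>.\<close>
  have "(\<lambda>n. inverse (real (Suc (2 * n)))) \<longlonglongrightarrow> 0"
    using LIMSEQ_subseq_LIMSEQ[OF LIMSEQ_inverse_real_of_nat, of "\<lambda>n. 2 * n"]
    by (simp add: o_def strict_mono_def)
  then have "(\<lambda>n. 1 + 2 * real R * inverse (real (Suc (2 * n)))) \<longlonglongrightarrow> 1 + 2 * real R * 0"
    by (intro tendsto_intros)
  moreover have "1 + 2 * real R * inverse (real (Suc (2 * n))) = (2 * real (n + R) + 1) / (2 * real n + 1)" for n
    by (simp add: field_simps)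
  ultimately have ratio: "(\<lambda>n. (2 * real (n + R) + 1) / (2 * real n + 1)) \<longlonglongrightarrow> 1" by simp
  have "(\<lambda>n. (((2 * real (n + R) + 1) / (2 * real n + 1)) ^ CARD('d) - 1) * N) \<longlonglongrightarrow> (1 ^ CARD('d) - 1) * N"
    by (intro tendsto_intros ratio)
  then have "(\<lambda>n. (v (n + R) / v n - 1) * N) \<longlonglongrightarrow> 0"
    by (simp add: v_def power_divide)
  moreover have "- (S / 2) \<le> (v (n + R) / v n - 1) * N" for n
    using key[of n] v0[of n] by (simp add: field_simps)
  ultimately have "- (S / 2) \<le> 0" by (intro LIMSEQ_le_const) auto
  then show False using S by simp
qed

section \<open>Supports and norms in the quasi-local algebra\<close>

locale quasi_local_algebra =
  fixes scC :: "complex \<Rightarrow> 'a::{real_normed_algebra_1,banach} \<Rightarrow> 'a"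
    and star :: "'a \<Rightarrow> 'a"
    and loc :: "(int ^ 'd) set \<Rightarrow> 'a set"
    and iota :: "int ^ 'd \<Rightarrow> 'a \<Rightarrow> 'a"
  assumes quasi_local: "quasi_local scC star loc iota"
begin

lemma cstar_alg: "cstar_alg scC star"
  using quasi_local[unfolded quasi_local_def, THEN conjunct1] .

lemma scC_of_real: "scC (complex_of_real r) a = r *\<^sub>R a"
  and scC_add_right: "scC c (a + b) = scC c a + scC c b"
  and scC_add_left: "scC (c + d) a = scC c a + scC d a"
  and scC_scC: "scC c (scC d a) = scC (c * d) a"
  and scC_mult_left: "scC c a * b = scC c (a * b)"
  and scC_mult_right: "a * scC c b = scC c (a * b)"
  and norm_scC: "norm (scC c a) = cmod c * norm a"
  and star_star: "star (star a) = a"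
  and star_add: "star (a + b) = star a + star b"
  and star_scC: "star (scC c a) = scC (cnj c) (star a)"
  and star_mult: "star (a * b) = star b * star a"
  and norm_star_mult_self: "norm (star a * a) = (norm a)\<^sup>2"
  using cstar_alg unfolding cstar_alg_def by (elim conjE, metis)+

lemma loc_eq_cspan: "finite X \<Longrightarrow> \<exists>F. finite F \<and> loc X = cspan scC F"
  using quasi_local[unfolded quasi_local_def, THEN conjunct2, THEN conjunct1] by blast

lemma loc_mult: "finite X \<Longrightarrow> a \<in> loc X \<Longrightarrow> b \<in> loc X \<Longrightarrow> a * b \<in> loc X"
  using quasi_local[unfolded quasi_local_def, THEN conjunct2, THEN conjunct2, THEN conjunct1] by blast

lemma loc_star: "finite X \<Longrightarrow> a \<in> loc X \<Longrightarrow> star a \<in> loc X"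
  using quasi_local[unfolded quasi_local_def, THEN conjunct2, THEN conjunct2, THEN conjunct1] by blast

lemma loc_empty: "loc {} = range (\<lambda>c. scC c 1)"
  using quasi_local[unfolded quasi_local_def, THEN conjunct2, THEN conjunct2, THEN conjunct2,
      THEN conjunct1] .

lemma loc_mono: "finite Y \<Longrightarrow> X \<subseteq> Y \<Longrightarrow> loc X \<subseteq> loc Y"
  using quasi_local[unfolded quasi_local_def, THEN conjunct2, THEN conjunct2, THEN conjunct2,
      THEN conjunct2, THEN conjunct1] by blast

lemma loc_Int: "finite X \<Longrightarrow> finite Y \<Longrightarrow> loc X \<inter> loc Y = loc (X \<inter> Y)"
  using quasi_local[unfolded quasi_local_def, THEN conjunct2, THEN conjunct2, THEN conjunct2,
      THEN conjunct2, THEN conjunct2, THEN conjunct1] by blast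

lemma commute_if_disjoint_supp:
  "A \<in> Oloc loc \<Longrightarrow> B \<in> Oloc loc \<Longrightarrow> supp loc A \<inter> supp loc B = {} \<Longrightarrow> A * B = B * A"
  using quasi_local[unfolded quasi_local_def, THEN conjunct2, THEN conjunct2, THEN conjunct2,
      THEN conjunct2, THEN conjunct2, THEN conjunct2, THEN conjunct2, THEN conjunct1] by blast

lemma iota_hom: "bij (iota x) \<and> iota x 1 = 1 \<and>
        (\<forall>a b. iota x (a + b) = iota x a + iota x b) \<and>
        (\<forall>a b. iota x (a * b) = iota x a * iota x b) \<and>
        (\<forall>c a. iota x (scC c a) = scC c (iota x a)) \<and>
        (\<forall>a. iota x (star a) = star (iota x a))"
  using quasi_local[unfolded quasi_local_def, THEN conjunct2, THEN conjunct2, THEN conjunct2,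
      THEN conjunct2, THEN conjunct2, THEN conjunct2, THEN conjunct2, THEN conjunct2,
      THEN conjunct1] by (rule spec)

lemma iota_one: "iota x 1 = 1"
  and iota_add: "iota x (a + b) = iota x a + iota x b"
  and iota_mult: "iota x (a * b) = iota x a * iota x b"
  and iota_scC: "iota x (scC c a) = scC c (iota x a)"
  and iota_star: "iota x (star a) = star (iota x a)"
  using iota_hom[of x] by blast+

lemma iota_iota: "iota x (iota y a) = iota (x + y) a"
proof -
  have "\<forall>x y. iota x \<circ> iota y = iota (x + y)"
    using quasi_local[unfolded quasi_local_def, THEN conjunct2, THEN conjunct2, THEN conjunct2,
        THEN conjunct2, THEN conjunct2, THEN conjunct2, THEN conjunct2, THEN conjunct2,
        THEN conjunct2, THEN conjunct1] .
  then show ?thesis by (metis comp_apply)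
qed

lemma iota_Oloc: "A \<in> Oloc loc \<Longrightarrow> iota x A \<in> Oloc loc"
  using quasi_local[unfolded quasi_local_def, THEN conjunct2, THEN conjunct2, THEN conjunct2,
      THEN conjunct2, THEN conjunct2, THEN conjunct2, THEN conjunct2, THEN conjunct2,
      THEN conjunct2, THEN conjunct2] by blast

lemma supp_iota: "A \<in> Oloc loc \<Longrightarrow> supp loc (iota x A) = (\<lambda>z. z + x) ` supp loc A"
  using quasi_local[unfolded quasi_local_def, THEN conjunct2, THEN conjunct2, THEN conjunct2,
      THEN conjunct2, THEN conjunct2, THEN conjunct2, THEN conjunct2, THEN conjunct2,
      THEN conjunct2, THEN conjunct2] by blast

lemma scC_one: "scC 1 a = a"
  using scC_of_real[of 1 a] by simp

lemma scC_zero: "scC 0 a = 0"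
  using scC_of_real[of 0 a] by simp

lemma linear_iota: "linear (iota x)"
  by (rule linearI) (simp_all add: iota_add iota_scC flip: scC_of_real)

lemma linear_star: "linear star"
  by (rule linearI) (simp_all add: star_add star_scC flip: scC_of_real)

lemma star_one: "star 1 = 1"
  by (metis mult.left_neutral mult.right_neutral star_mult star_star)

text \<open>Evaluating a positive functional on this expansion, for suitable \<open>c\<close>,
  yields hermiticity and the variance inequality of states.\<close>

lemma star_mult_add_scalar:
  "star (a + scC c 1) * (a + scC c 1) =
     star a * a + scC c (star a) + scC (cnj c) a + scC (cnj c * c) 1"
  by (simp add: star_add star_scC star_one distrib_left distrib_right scC_add_right
      scC_mult_left scC_mult_right scC_scC mult.commute add.assoc)

text \<open>The C*-identity and submultiplicativity give one inequality; applying it to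
  \<open>star a\<close> gives the other.\<close>

lemma norm_star: "norm (star a) = norm a"
proof -
  have le: "norm b \<le> norm (star b)" for b
  proof (cases "b = 0")
    case False
    have "norm b * norm b \<le> norm (star b) * norm b"
      by (metis norm_mult_ineq norm_star_mult_self power2_eq_square)
    then show ?thesis using False by simp
  qed simp
  show ?thesis using le[of a] le[of "star a"] by (simp add: star_star)
qed

text \<open>Padding with zero coefficients fixes the index set, so that linear combinations can be
  added and scaled coefficientwise.\<close>

lemma cspan_finite_eq:
  assumes "finite F"
  shows "cspan scC F = range (\<lambda>c. \<Sum>b\<in>F. scC (c b) b)"
proof (intro equalityI subsetI)
  fix x assume "x \<in> cspan scC F"
  then obtain B c where B: "B \<subseteq> F" and x: "x = (\<Sum>b\<in>B. scC (c b) b)"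
    unfolding cspan_def by blast
  have "x = (\<Sum>b\<in>F. scC (if b \<in> B then c b else 0) b)"
    unfolding x using B assms by (intro sum.mono_neutral_cong_left) (auto simp: scC_zero)
  then show "x \<in> range (\<lambda>c. \<Sum>b\<in>F. scC (c b) b)"
    by (rule range_eqI[where x = "\<lambda>b. if b \<in> B then c b else 0"])
next
  fix x assume "x \<in> range (\<lambda>c. \<Sum>b\<in>F. scC (c b) b)"
  then show "x \<in> cspan scC F" unfolding cspan_def using assms by blast
qed

lemma scC_sum: "scC c (sum f I) = (\<Sum>i\<in>I. scC c (f i))"
proof -
  have "scC c 0 = 0" using norm_scC[of c 0] by simp
  then show ?thesis by (induction I rule: infinite_finite_induct) (simp_all add: scC_add_right)
qed

lemma loc_add:
  assumes "finite X" "a \<in> loc X" "b \<in> loc X"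
  shows "a + b \<in> loc X"
proof -
  obtain F where F: "finite F" "loc X = range (\<lambda>c. \<Sum>b\<in>F. scC (c b) b)"
    using loc_eq_cspan[OF assms(1)] cspan_finite_eq by metis
  obtain c d where "a = (\<Sum>b\<in>F. scC (c b) b)" "b = (\<Sum>b\<in>F. scC (d b) b)"
    using assms(2,3) unfolding F(2) by (elim rangeE)
  then have "a + b = (\<Sum>b\<in>F. scC (c b + d b) b)" by (simp add: scC_add_left sum.distrib)
  then show ?thesis unfolding F(2) by (rule range_eqI[where x = "\<lambda>b. c b + d b"])
qed

lemma loc_scC:
  assumes "finite X" "a \<in> loc X"
  shows "scC k a \<in> loc X"
proof -
  obtain F where F: "finite F" "loc X = range (\<lambda>c. \<Sum>b\<in>F. scC (c b) b)"
    using loc_eq_cspan[OF assms(1)] cspan_finite_eq by metis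
  obtain c where "a = (\<Sum>b\<in>F. scC (c b) b)" using assms(2) unfolding F(2) by (rule rangeE)
  then have "scC k a = (\<Sum>b\<in>F. scC (k * c b) b)" by (simp add: scC_sum scC_scC)
  then show ?thesis unfolding F(2) by (rule range_eqI[where x = "\<lambda>b. k * c b"])
qed

lemma one_in_loc: "finite X \<Longrightarrow> 1 \<in> loc X"
  using loc_empty loc_mono[of X "{}"] scC_one[of 1] by (metis empty_subsetI in_mono rangeI)

lemma power_in_loc: "finite X \<Longrightarrow> a \<in> loc X \<Longrightarrow> a ^ n \<in> loc X"
  by (induction n) (simp_all add: one_in_loc loc_mult)

text \<open>A complex span of \<open>F\<close> lies in the real span of \<open>F\<close> together
  with \<open>\<i>\<close> times \<open>F\<close>, where real linear maps are bounded.\<close>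

lemma linear_bounded_on_loc:
  fixes f :: "'a \<Rightarrow> 'b::real_normed_vector"
  assumes "finite X" "linear f"
  obtains K where "\<And>a. a \<in> loc X \<Longrightarrow> norm (f a) \<le> K * norm a"
proof -
  obtain F where F: "finite F" "loc X = range (\<lambda>c. \<Sum>b\<in>F. scC (c b) b)"
    using loc_eq_cspan[OF assms(1)] cspan_finite_eq by metis
  have "scC (c b) b = Re (c b) *\<^sub>R b + Im (c b) *\<^sub>R scC \<i> b" for c b
  proof -
    have "c b = of_real (Re (c b)) + of_real (Im (c b)) * \<i>" by (simp add: complex_eq_iff)
    then have "scC (c b) b = scC (of_real (Re (c b))) b + scC (of_real (Im (c b))) (scC \<i> b)"
      by (metis scC_add_left scC_scC)
    then show ?thesis by (simp only: scC_of_real)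
  qed
  then have "scC (c b) b \<in> span (F \<union> scC \<i> ` F)" if "b \<in> F" for c b
    by (simp only:) (intro span_add span_mul; rule span_base; simp add: that)
  then have "loc X \<subseteq> span (F \<union> scC \<i> ` F)" unfolding F by (auto intro: span_sum)
  then show ?thesis
    using linear_bounded_on_finite_span[of "F \<union> scC \<i> ` F" f] that F assms(2) by (metis finite_Un finite_imageI in_mono)
qed

lemma Oloc_iff: "A \<in> Oloc loc \<longleftrightarrow> (\<exists>X. finite X \<and> A \<in> loc X)"
  unfolding Oloc_def by blast

text \<open>Take a localisation region of least cardinality. Its intersection with any other region
  again localises \<open>A\<close>, so minimality makes it a subset of that region.\<close>

lemma supp_spec:
  assumes "A \<in> Oloc loc"
  shows "finite (supp loc A) \<and> A \<in> loc (supp loc A) \<and> (\<forall>Y. finite Y \<longrightarrow> A \<in> loc Y \<longrightarrow> supp loc A \<subseteq> Y)"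
  unfolding supp_def
proof (rule theI')
  obtain X where X: "finite X \<and> A \<in> loc X" and min: "\<And>Y. finite Y \<and> A \<in> loc Y \<Longrightarrow> card X \<le> card Y"
    using assms ex_has_least_nat[of "\<lambda>X. finite X \<and> A \<in> loc X" _ card] unfolding Oloc_iff by metis
  have "X \<subseteq> Y" if "finite Y" "A \<in> loc Y" for Y
  proof -
    have "A \<in> loc (X \<inter> Y)" using X that loc_Int by blast
    then have "card X \<le> card (X \<inter> Y)" using X by (intro min) auto
    then show ?thesis using X by (metis Int_lower1 card_seteq inf.absorb_iff1)
  qed
  then show "\<exists>!X. finite X \<and> A \<in> loc X \<and> (\<forall>Y. finite Y \<longrightarrow> A \<in> loc Y \<longrightarrow> X \<subseteq> Y)"
    using X by (intro ex1I[of _ X]) (auto intro: subset_antisym)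
qed

lemma finite_supp: "A \<in> Oloc loc \<Longrightarrow> finite (supp loc A)"
  and in_loc_supp: "A \<in> Oloc loc \<Longrightarrow> A \<in> loc (supp loc A)"
  using supp_spec by blast+

lemma supp_subset: "finite Y \<Longrightarrow> A \<in> loc Y \<Longrightarrow> supp loc A \<subseteq> Y"
  using supp_spec[of A] by (auto simp: Oloc_iff)

lemma Oloc_star: "A \<in> Oloc loc \<Longrightarrow> star A \<in> Oloc loc"
  using loc_star by (auto simp: Oloc_iff)

lemma supp_star: "A \<in> Oloc loc \<Longrightarrow> supp loc (star A) = supp loc A"
  by (metis Oloc_star finite_supp in_loc_supp loc_star star_star subset_antisym supp_subset)

lemma in_loc_union:
  assumes "A \<in> Oloc loc" "B \<in> Oloc loc"
  shows "A \<in> loc (supp loc A \<union> supp loc B)" "B \<in> loc (supp loc A \<union> supp loc B)"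
  using assms in_loc_supp finite_supp loc_mono[of "supp loc A \<union> supp loc B"] by blast+

lemma Oloc_mult: "A \<in> Oloc loc \<Longrightarrow> B \<in> Oloc loc \<Longrightarrow> A * B \<in> Oloc loc"
  using in_loc_union loc_mult finite_supp by (metis Oloc_iff finite_Un)

lemma supp_mult_subset:
  "A \<in> Oloc loc \<Longrightarrow> B \<in> Oloc loc \<Longrightarrow> supp loc (A * B) \<subseteq> supp loc A \<union> supp loc B"
  using in_loc_union loc_mult finite_supp by (intro supp_subset) auto

text \<open>Infinite distance arises only from an empty support, so this reduces that case to
  scalars.\<close>

lemma scalar_if_supp_empty:
  assumes "A \<in> Oloc loc" "supp loc A = {}"
  obtains c where "A = scC c 1"
  using in_loc_supp[OF assms(1)] that unfolding assms(2) loc_empty by blast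

text \<open>For selfadjoint elements the C*-identity says that squaring commutes with the norm;
  iterating it reaches the exponents \<open>2 ^ n\<close>.\<close>

lemma norm_selfadjoint_power:
  assumes "star a = a"
  shows "norm (a ^ (2 ^ n)) = norm a ^ (2 ^ n)"
proof (induction n)
  case (Suc n)
  have "star (a ^ k) = a ^ k" for k
    by (induction k) (simp_all add: star_one star_mult assms power_commutes)
  then have "norm (a ^ (2 ^ n) * a ^ (2 ^ n)) = (norm (a ^ (2 ^ n)))\<^sup>2"
    using norm_star_mult_self[of "a ^ (2 ^ n)"] by simp
  then show ?case using Suc by (simp add: mult_2 power_add power2_eq_square)
qed simp

text \<open>Finite dimensionality of the local algebras gives some bound; applying it to the
  \<open>2\<^sup>n\<close>-th powers of \<open>A\<^sup>* A\<close> removes the constant. The same argument bounds states below.\<close>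

lemma norm_iota_le:
  assumes "A \<in> Oloc loc"
  shows "norm (iota x A) \<le> norm A"
proof -
  obtain X where X: "finite X" "A \<in> loc X" using assms Oloc_iff by auto
  obtain K where K: "\<And>a. a \<in> loc X \<Longrightarrow> norm (iota x a) \<le> K * norm a"
    using linear_bounded_on_loc[OF X(1) linear_iota] by blast
  define b where "b = star A * A"
  have sb: "star b = b" by (simp add: b_def star_mult star_star)
  have sib: "star (iota x b) = iota x b" by (metis iota_star sb)
  \<comment> \<open>All powers of \<open>b\<close> stay in the same \<open>loc X\<close>, so one
    constant \<open>K\<close> serves for all of them.\<close>
  have b: "b \<in> loc X" using X by (simp add: b_def loc_mult loc_star)
  have pow: "iota x (b ^ k) = iota x b ^ k" for k
    by (induction k) (simp_all add: iota_one iota_mult)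
  have "norm (iota x b) \<le> norm b"
  proof (rule le_if_dyadic_powers_le)
    fix n :: nat
    show "norm (iota x b) ^ 2 ^ n \<le> K * norm b ^ 2 ^ n"
      using K[OF power_in_loc[OF X(1) b, of "2 ^ n"]]
      by (simp add: pow norm_selfadjoint_power[OF sb] norm_selfadjoint_power[OF sib])
  qed auto
  moreover have "norm (iota x b) = (norm (iota x A))\<^sup>2"
    by (simp add: b_def iota_mult iota_star norm_star_mult_self)
  ultimately have "(norm (iota x A))\<^sup>2 \<le> (norm A)\<^sup>2"
    by (simp add: b_def norm_star_mult_self)
  then show ?thesis by (rule power2_le_imp_le) simp
qed

end

section \<open>Hermiticity, variance and boundedness of states\<close>

locale invariant_state = quasi_local_algebra scC star loc iota
  for scC :: "complex \<Rightarrow> 'a::{real_normed_algebra_1,banach} \<Rightarrow> 'a"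
    and star :: "'a \<Rightarrow> 'a"
    and loc :: "(int ^ 'd) set \<Rightarrow> 'a set"
    and iota :: "int ^ 'd \<Rightarrow> 'a \<Rightarrow> 'a" +
  fixes \<omega> :: "'a \<Rightarrow> complex"
  assumes state: "is_state scC star \<omega>"
    and invariant: "\<omega> (iota x a) = \<omega> a"
begin

lemma state_add: "\<omega> (a + b) = \<omega> a + \<omega> b"
  and state_scC: "\<omega> (scC c a) = c * \<omega> a"
  and state_one: "\<omega> 1 = 1"
  and state_pos: "Im (\<omega> (star a * a)) = 0" "Re (\<omega> (star a * a)) \<ge> 0"
  using state unfolding is_state_def by blast+

lemma linear_state: "linear \<omega>"
proof (rule linearI)
  show "\<omega> (r *\<^sub>R b) = r *\<^sub>R \<omega> b" for r b
    using state_scC[of "complex_of_real r" b] by (simp add: scC_of_real scaleR_conv_of_real[of _ "\<omega> b"])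
qed (rule state_add)

text \<open>Positivity makes the value at \<open>star (a + scC c 1) * (a + scC c 1)\<close> real.
  The choice \<open>c = \<i>\<close> compares the real parts, \<open>c = 1\<close> the imaginary
  parts.\<close>

lemma state_star: "\<omega> (star a) = cnj (\<omega> a)"
proof (rule complex_eqI)
  have "\<omega> (star (a + scC c 1) * (a + scC c 1)) =
      \<omega> (star a * a) + c * \<omega> (star a) + cnj c * \<omega> a + cnj c * c" for c
    by (simp add: star_mult_add_scalar state_add state_scC state_one)
  then have im: "Im (c * \<omega> (star a) + cnj c * \<omega> a + cnj c * c) = 0" for c
    using state_pos(1)[of "a + scC c 1"] state_pos(1)[of a] by simp
  show "Re (\<omega> (star a)) = Re (cnj (\<omega> a))" using im[of \<i>] by simp
  show "Im (\<omega> (star a)) = Im (cnj (\<omega> a))" using im[of 1] by simp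
qed

text \<open>Positivity is applied to the centred element, that is \<open>a\<close> shifted by the
  scalar \<open>- \<omega> a\<close>.\<close>

lemma state_variance_nonneg: "(cmod (\<omega> a))\<^sup>2 \<le> Re (\<omega> (star a * a))"
proof -
  define c where "c = - \<omega> a"
  have "\<omega> (star (a + scC c 1) * (a + scC c 1)) = \<omega> (star a * a) - \<omega> a * cnj (\<omega> a)"
    by (simp add: star_mult_add_scalar state_add state_scC state_one state_star c_def)
  then have "0 \<le> Re (\<omega> (star a * a) - \<omega> a * cnj (\<omega> a))"
    using state_pos(2)[of "a + scC c 1"] by simp
  then show ?thesis by (simp add: complex_mult_cnj cmod_power2)
qed

lemma state_norm_le:
  assumes "A \<in> Oloc loc"
  shows "cmod (\<omega> A) \<le> norm A"
proof -
  obtain X where X: "finite X" "A \<in> loc X" using assms Oloc_iff by auto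
  obtain K where K: "\<And>a. a \<in> loc X \<Longrightarrow> norm (\<omega> a) \<le> K * norm a"
    using linear_bounded_on_loc[OF X(1) linear_state] by blast
  define b where "b = star A * A"
  have sb: "star b = b" by (simp add: b_def star_mult star_star)
  have sp: "star (b ^ k) = b ^ k" for k
    by (induction k) (simp_all add: star_one star_mult sb power_commutes)
  have b: "b \<in> loc X" using X by (simp add: b_def loc_mult loc_star)
  \<comment> \<open>States are not multiplicative, but the variance inequality at each power of
    \<open>b\<close> doubles the exponent in the right direction.\<close>
  have pow: "cmod (\<omega> b) ^ 2 ^ n \<le> cmod (\<omega> (b ^ 2 ^ n))" for n
  proof (induction n)
    case (Suc n)
    have "cmod (\<omega> b) ^ 2 ^ Suc n = (cmod (\<omega> b) ^ 2 ^ n)\<^sup>2"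
      by (simp add: mult.commute flip: power_mult)
    also have "\<dots> \<le> (cmod (\<omega> (b ^ 2 ^ n)))\<^sup>2" using Suc by (intro power_mono) auto
    also have "\<dots> \<le> Re (\<omega> (star (b ^ 2 ^ n) * b ^ 2 ^ n))" by (rule state_variance_nonneg)
    also have "\<dots> \<le> cmod (\<omega> (star (b ^ 2 ^ n) * b ^ 2 ^ n))" by (rule complex_Re_le_cmod)
    also have "star (b ^ 2 ^ n) * b ^ 2 ^ n = b ^ 2 ^ Suc n" by (simp add: sp mult_2 power_add)
    finally show ?case .
  qed simp
  have "cmod (\<omega> b) \<le> norm b"
  proof (rule le_if_dyadic_powers_le)
    fix n :: nat
    show "cmod (\<omega> b) ^ 2 ^ n \<le> K * norm b ^ 2 ^ n"
      using K[OF power_in_loc[OF X(1) b, of "2 ^ n"]] pow[of n]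
      by (simp add: norm_selfadjoint_power[OF sb])
  qed auto
  then have "(cmod (\<omega> A))\<^sup>2 \<le> (norm A)\<^sup>2"
    using state_variance_nonneg[of A] complex_Re_le_cmod[of "\<omega> b"] norm_star_mult_self[of A]
    unfolding b_def by linarith
  then show ?thesis by (rule power2_le_imp_le) simp
qed

end

section \<open>Interpolation and distances between supports\<close>

text \<open>Writing \<open>t\<close> as \<open>t powr (1 - \<theta>) * t powr \<theta>\<close> lets
  each factor use its own bound. This combines a bound uniform in the translation with one that is
  summable over translations.\<close>

lemma le_powr_interpolate:
  fixes t u v \<theta> :: real
  assumes "0 \<le> t" "t \<le> u" "t \<le> v" "0 \<le> \<theta>" "\<theta> \<le> 1"
  shows "t \<le> u powr (1 - \<theta>) * v powr \<theta>"
proof (cases "t = 0")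
  case False
  have "t = t powr (1 - \<theta>) * t powr \<theta>" using False assms(1) by (simp flip: powr_add)
  also have "\<dots> \<le> u powr (1 - \<theta>) * v powr \<theta>"
    using assms by (intro mult_mono powr_mono2) auto
  finally show ?thesis .
qed simp

lemma norm_diff_diff_le: "norm (a - b - c) \<le> norm a + norm b + norm (c :: 'b::real_normed_vector)"
  using norm_triangle_ineq4[of "a - b" c] norm_triangle_ineq4[of a b] by linarith

lemma has_sum_finite_sum:
  fixes f :: "'i \<Rightarrow> 'b \<Rightarrow> real"
  assumes "finite I" "\<And>i. i \<in> I \<Longrightarrow> (f i has_sum s i) A"
  shows "((\<lambda>x. \<Sum>i\<in>I. f i x) has_sum (\<Sum>i\<in>I. s i)) A"
  using assms
proof (induction I rule: finite_induct)
  case (insert i I)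
  then show ?case by (simp add: has_sum_add)
qed simp

lemma ldist_add_right: "ldist (x + z) (y + z) = ldist x y"
  by (simp add: ldist_def)

text \<open>The pair realises the distance from the translate of \<open>X\<close> by
  \<open>x\<close> to \<open>Y\<close>, so that the decay at this distance is a single summand of a
  sum over pairs.\<close>

lemma exists_nearest_pair:
  assumes "finite X" "finite Y" "X \<noteq> {}" "Y \<noteq> {}"
  obtains a b where "a \<in> X" "b \<in> Y" "\<And>a' b'. a' \<in> X \<Longrightarrow> b' \<in> Y \<Longrightarrow> ldist (a + x) b \<le> ldist (a' + x) b'"
proof -
  define D where "D = (\<lambda>(a, b). ldist (a + x) b) ` (X \<times> Y)"
  have D: "finite D" "D \<noteq> {}" using assms by (auto simp: D_def)
  have "Min D \<in> (\<lambda>(a, b). ldist (a + x) b) ` (X \<times> Y)"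
    using Min_in[OF D] by (simp only: D_def)
  then obtain a b where ab: "a \<in> X" "b \<in> Y" "Min D = ldist (a + x) b" by auto
  have "ldist (a + x) b \<le> ldist (a' + x) b'" if "a' \<in> X" "b' \<in> Y" for a' b'
    using that D unfolding ab(3)[symmetric] by (intro Min_le) (auto simp: D_def)
  then show ?thesis using that ab by blast
qed

lemma finite_ldist_values:
  assumes "finite X" "finite Y"
  shows "finite {ldist x y | x y. x \<in> X \<and> y \<in> Y}"
proof -
  have "{ldist x y | x y. x \<in> X \<and> y \<in> Y} = (\<lambda>(x, y). ldist x y) ` (X \<times> Y)" by auto
  then show ?thesis using assms by simp
qed

lemma sdist_le_ldist:
  assumes "sdist loc A B = Some r" "finite (supp loc A)" "finite (supp loc B)"
    and "a \<in> supp loc A" "b \<in> supp loc B"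
  shows "r \<le> ldist a b"
proof -
  have "r = Min {ldist x y | x y. x \<in> supp loc A \<and> y \<in> supp loc B}"
    using assms(1) by (simp add: sdist_def split: if_splits)
  then show ?thesis using assms finite_ldist_values[OF assms(2,3)] by (auto intro: Min_le)
qed

lemma sdist_attained:
  assumes "sdist loc A B = Some r" "finite (supp loc A)" "finite (supp loc B)"
  obtains a b where "a \<in> supp loc A" "b \<in> supp loc B" "r = ldist a b"
proof -
  let ?D = "{ldist x y | x y. x \<in> supp loc A \<and> y \<in> supp loc B}"
  have "r = Min ?D" "?D \<noteq> {}"
    using assms(1) by (auto simp add: sdist_def split: if_splits)
  then have "r \<in> ?D" using Min_in[OF finite_ldist_values[OF assms(2,3)]] by blast
  then show ?thesis using that by blast
qed

lemma ldist_le_sdiam: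
  assumes "finite (supp loc A)" "a \<in> supp loc A" "b \<in> supp loc A"
  shows "ldist a b \<le> sdiam loc A"
  unfolding sdiam_def using assms finite_ldist_values[OF assms(1,1)] by (intro Max_ge) auto

lemma sdiam_nonneg: "finite (supp loc A) \<Longrightarrow> 0 \<le> sdiam loc A"
  unfolding sdiam_def by (intro Max_ge finite.insertI finite_ldist_values) auto

text \<open>\<open>h\<close> is a monotone majorant of the decay function \<open>f\<close>, and \<open>\<theta>\<close> splits the decay: the power
  \<open>h\<^sup>\<theta>\<close> is spent on summing over translations, the power \<open>h\<^bsup>1 - \<theta>\<^esup>\<close> is the decay of the form.\<close>

locale dominated_clustering = invariant_state scC star loc iota \<omega>
  for scC :: "complex \<Rightarrow> 'a::{real_normed_algebra_1,banach} \<Rightarrow> 'a"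
    and star :: "'a \<Rightarrow> 'a"
    and loc :: "(int ^ 'd) set \<Rightarrow> 'a set"
    and iota :: "int ^ 'd \<Rightarrow> 'a \<Rightarrow> 'a"
    and \<omega> :: "'a \<Rightarrow> complex" +
  fixes \<nu> :: "nat \<Rightarrow> real" and f :: "int \<Rightarrow> real" and h :: "real \<Rightarrow> real" and \<theta> :: real
  assumes \<nu>_nonneg: "0 \<le> \<nu> n"
    and f_le_h: "0 \<le> d \<Longrightarrow> f d \<le> h (real_of_int d)"
    and h_nonneg: "0 \<le> h t"
    and h_antimono: "0 \<le> s \<Longrightarrow> s \<le> t \<Longrightarrow> h t \<le> h s"
    and clustering: "A \<in> Oloc loc \<Longrightarrow> B \<in> Oloc loc \<Longrightarrow>
        card (supp loc A) < l \<Longrightarrow> card (supp loc B) < l \<Longrightarrow>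
        cmod (\<omega> (A * B) - \<omega> A * \<omega> B) \<le> \<nu> l * norm A * norm B * fb f (sdist loc A B)"
    and \<theta>: "0 < \<theta>" "\<theta> < 1"
    and h_summable: "(\<lambda>x::int^'d. h (real_of_int (ldist x 0)) powr \<theta>) summable_on UNIV"
begin

section \<open>Summable bounds for the correlations of translates\<close>

text \<open>As \<open>h\<close> is antitone, any lower bound \<open>d\<close> on the pairwise
  distances may replace the exact distance. This suits products, whose support is only known up to
  inclusion.\<close>

lemma clustering_le:
  assumes AB: "A \<in> Oloc loc" "B \<in> Oloc loc" and l: "card (supp loc A) < l" "card (supp loc B) < l"
    and d: "0 \<le> d" "\<And>x y. x \<in> supp loc A \<Longrightarrow> y \<in> supp loc B \<Longrightarrow> d \<le> real_of_int (ldist x y)"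
  shows "cmod (\<omega> (A * B) - \<omega> A * \<omega> B) \<le> \<nu> l * norm A * norm B * h d"
proof -
  have "fb f (sdist loc A B) \<le> h d"
  proof (cases "sdist loc A B")
    case None
    then show ?thesis by (simp add: fb_def h_nonneg)
  next
    case (Some r)
    obtain x y where xy: "x \<in> supp loc A" "y \<in> supp loc B" "r = ldist x y"
      using sdist_attained[OF Some] AB finite_supp by blast
    have "f r \<le> h (real_of_int r)" by (rule f_le_h) (simp add: xy ldist_nonneg)
    also have "\<dots> \<le> h d" using d xy by (intro h_antimono) auto
    finally show ?thesis by (simp add: Some fb_def)
  qed
  then have "\<nu> l * norm A * norm B * fb f (sdist loc A B) \<le> \<nu> l * norm A * norm B * h d"
    by (intro mult_left_mono) (simp_all add: \<nu>_nonneg)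
  then show ?thesis using clustering[OF AB l] by linarith
qed

text \<open>Summing over all pairs dominates the decay at the nearest pair, while each single pair
  gives a shift of one and the same function of \<open>x\<close>.\<close>

definition pair_decay :: "(int^'d) set \<Rightarrow> (int^'d) set \<Rightarrow> int^'d \<Rightarrow> real" where
  "pair_decay X Y x = (\<Sum>a\<in>X. \<Sum>b\<in>Y. h (real_of_int (ldist (a + x) b)) powr \<theta>)"

definition total_decay :: real where
  "total_decay = (\<Sum>\<^sub>\<infinity>x::int^'d. h (real_of_int (ldist x 0)) powr \<theta>)"

lemma total_decay_nonneg: "0 \<le> total_decay"
  unfolding total_decay_def by (rule infsum_nonneg) simp

lemma pair_decay_nonneg: "0 \<le> pair_decay X Y x"
  unfolding pair_decay_def by (intro sum_nonneg) simp

text \<open>For a fixed pair, \<open>x \<mapsto> x + (a - b)\<close> is a bijection of the lattice,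
  so every pair contributes \<open>total_decay\<close>.\<close>

lemma pair_decay_has_sum:
  assumes "finite X" "finite Y"
  shows "(pair_decay X Y has_sum (real (card X) * real (card Y) * total_decay)) UNIV"
proof -
  have one: "((\<lambda>x. h (real_of_int (ldist (a + x) b)) powr \<theta>) has_sum total_decay) UNIV"
    for a b :: "int^'d"
  proof -
    have bij: "bij_betw (\<lambda>x. x + (a - b)) UNIV (UNIV :: (int^'d) set)"
      by (rule bij_betwI[where g = "\<lambda>x. x - (a - b)"]) auto
    have "((\<lambda>x::int^'d. h (real_of_int (ldist x 0)) powr \<theta>) has_sum total_decay) UNIV"
      unfolding total_decay_def by (rule has_sum_infsum[OF h_summable])
    then have "((\<lambda>x::int^'d. h (real_of_int (ldist (x + (a - b)) 0)) powr \<theta>) has_sum total_decay) UNIV"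
      using has_sum_reindex_bij_betw[OF bij, of "\<lambda>x. h (real_of_int (ldist x 0)) powr \<theta>"] by blast
    moreover have "ldist (x + (a - b)) 0 = ldist (a + x) b" for x
      using ldist_add_right[of "x + (a - b)" b 0] by (simp add: algebra_simps)
    ultimately show ?thesis by simp
  qed
  have "((\<lambda>x. \<Sum>a\<in>X. \<Sum>b\<in>Y. h (real_of_int (ldist (a + x) b)) powr \<theta>) has_sum
      (\<Sum>a\<in>X. \<Sum>b\<in>Y. total_decay)) UNIV"
    by (intro has_sum_finite_sum assms one)
  then show ?thesis by (simp add: pair_decay_def[abs_def] mult.assoc)
qed

lemma le_pair_decay:
  assumes "finite X" "finite Y" "a \<in> X" "b \<in> Y"
  shows "h (real_of_int (ldist (a + x) b)) powr \<theta> \<le> pair_decay X Y x"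
proof -
  have "h (real_of_int (ldist (a + x) b)) powr \<theta> \<le> (\<Sum>b\<in>Y. h (real_of_int (ldist (a + x) b)) powr \<theta>)"
    using assms by (intro member_le_sum) auto
  also have "\<dots> \<le> pair_decay X Y x" unfolding pair_decay_def
    using assms by (intro member_le_sum[of a X "\<lambda>a. \<Sum>b\<in>Y. h (real_of_int (ldist (a + x) b)) powr \<theta>"])
      (auto intro: sum_nonneg)
  finally show ?thesis .
qed

abbreviation corr :: "'a \<Rightarrow> 'a \<Rightarrow> int^'d \<Rightarrow> complex" where
  "corr \<equiv> corr_term star iota \<omega>"

lemma state_star_iota: "\<omega> (star (iota x A)) = \<omega> (star A)"
  by (metis invariant iota_star)

lemma corr_scalar_right: "corr A (scC c 1) x = 0"
  by (simp add: corr_term_def scC_mult_right state_scC state_one state_star_iota)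

lemma corr_scalar_left: "corr (scC c 1) B x = 0"
  by (simp add: corr_term_def iota_scC iota_one star_scC star_one scC_mult_left state_scC state_one)

lemma corr_eq_0_if_supp_empty:
  assumes "A \<in> Oloc loc" "B \<in> Oloc loc" "supp loc A = {} \<or> supp loc B = {}"
  shows "corr A B x = 0"
  using assms(3)
proof
  assume "supp loc A = {}"
  then show ?thesis using scalar_if_supp_empty[OF assms(1)] corr_scalar_left by metis
next
  assume "supp loc B = {}"
  then show ?thesis using scalar_if_supp_empty[OF assms(2)] corr_scalar_right by metis
qed

lemma star_iota:
  assumes "A \<in> Oloc loc"
  shows star_iota_Oloc: "star (iota x A) \<in> Oloc loc"
    and supp_star_iota: "supp loc (star (iota x A)) = (\<lambda>z. z + x) ` supp loc A"
    and card_supp_star_iota: "card (supp loc (star (iota x A))) = card (supp loc A)"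
    and norm_star_iota_le: "norm (star (iota x A)) \<le> norm A"
proof -
  show "star (iota x A) \<in> Oloc loc" using assms by (intro Oloc_star iota_Oloc)
  show s: "supp loc (star (iota x A)) = (\<lambda>z. z + x) ` supp loc A"
    using assms by (simp add: supp_star iota_Oloc supp_iota)
  show "card (supp loc (star (iota x A))) = card (supp loc A)"
    unfolding s by (rule card_image) (simp add: inj_on_def)
  show "norm (star (iota x A)) \<le> norm A" using assms by (simp add: norm_star norm_iota_le)
qed

lemma corr_le:
  assumes AB: "A \<in> Oloc loc" "B \<in> Oloc loc" and l: "card (supp loc A) < l" "card (supp loc B) < l"
    and d: "0 \<le> d" "\<And>a b. a \<in> supp loc A \<Longrightarrow> b \<in> supp loc B \<Longrightarrow> d \<le> real_of_int (ldist (a + x) b)"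
  shows "cmod (corr A B x) \<le> \<nu> l * norm A * norm B * h d"
proof -
  have "cmod (\<omega> (star (iota x A) * B) - \<omega> (star (iota x A)) * \<omega> B)
      \<le> \<nu> l * norm (star (iota x A)) * norm B * h d"
  proof (rule clustering_le)
    show "card (supp loc (star (iota x A))) < l" using l card_supp_star_iota[OF AB(1)] by simp
  qed (use AB l d star_iota_Oloc supp_star_iota[OF AB(1)] in auto)
  also have "\<dots> \<le> \<nu> l * norm A * norm B * h d"
    by (intro mult_right_mono mult_left_mono norm_star_iota_le AB) (simp_all add: \<nu>_nonneg h_nonneg)
  finally show ?thesis by (simp add: corr_term_def state_star_iota)
qed

lemma corr_le_pair_decay:
  assumes AB: "A \<in> Oloc loc" "B \<in> Oloc loc" and l: "card (supp loc A) < l" "card (supp loc B) < l"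
  shows "cmod (corr A B x)
    \<le> \<nu> l * norm A * norm B * (h 0 powr (1 - \<theta>) * pair_decay (supp loc A) (supp loc B) x)"
proof (cases "supp loc A = {} \<or> supp loc B = {}")
  case True
  then show ?thesis
    using corr_eq_0_if_supp_empty[OF AB] by (simp add: \<nu>_nonneg pair_decay_nonneg)
next
  case False
  note fin = AB[THEN finite_supp]
  obtain a b where ab: "a \<in> supp loc A" "b \<in> supp loc B"
    and min: "\<And>a' b'. a' \<in> supp loc A \<Longrightarrow> b' \<in> supp loc B \<Longrightarrow> ldist (a + x) b \<le> ldist (a' + x) b'"
    using exists_nearest_pair[OF fin, of x] False by blast
  define d where "d = real_of_int (ldist (a + x) b)"
  have d0: "0 \<le> d" by (simp add: d_def ldist_nonneg)
  have "cmod (corr A B x) \<le> \<nu> l * norm A * norm B * h d"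
    using d0 min by (intro corr_le AB l) (auto simp: d_def)
  \<comment> \<open>Only the power \<open>\<theta>\<close> of the decay is kept for the summation;
    the other factor is bounded by its value at distance 0.\<close>
  also have "h d \<le> h 0 powr (1 - \<theta>) * h d powr \<theta>"
    using \<theta> d0 by (intro le_powr_interpolate h_antimono h_nonneg) auto
  also have "\<dots> \<le> h 0 powr (1 - \<theta>) * pair_decay (supp loc A) (supp loc B) x"
    unfolding d_def by (intro mult_left_mono le_pair_decay fin ab) simp
  finally show ?thesis by (simp add: mult_left_mono \<nu>_nonneg)
qed

lemma corr_bound_has_sum:
  assumes "A \<in> Oloc loc" "B \<in> Oloc loc"
  shows "((\<lambda>x. k * pair_decay (supp loc A) (supp loc B) x) has_sum
    (k * (real (card (supp loc A)) * real (card (supp loc B)) * total_decay))) UNIV"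
  using assms by (intro has_sum_cmult_right pair_decay_has_sum finite_supp)

lemma corr_summable:
  assumes AB: "A \<in> Oloc loc" "B \<in> Oloc loc"
  shows "corr A B summable_on UNIV"
proof -
  \<comment> \<open>The clustering bound asks for cardinalities strictly below \<open>l\<close>,
    hence the successor.\<close>
  define l where "l = Suc (card (supp loc A) + card (supp loc B))"
  have "(\<lambda>x. \<nu> l * norm A * norm B * h 0 powr (1 - \<theta>) * pair_decay (supp loc A) (supp loc B) x) summable_on UNIV"
    using corr_bound_has_sum[OF AB] has_sum_imp_summable by blast
  then have "(\<lambda>x. cmod (corr A B x)) summable_on UNIV"
  proof (rule Infinite_Sum.abs_summable_on_comparison_test')
    show "cmod (corr A B x) \<le> \<nu> l * norm A * norm B * h 0 powr (1 - \<theta>) * pair_decay (supp loc A) (supp loc B) x" for x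
      using corr_le_pair_decay[OF AB, of l x] by (simp add: l_def mult.assoc)
  qed
  then show ?thesis by (rule abs_summable_summable)
qed

section \<open>Sesquilinearity, invariance, positivity and boundedness of the form\<close>

abbreviation form :: "'a \<Rightarrow> 'a \<Rightarrow> complex" where
  "form \<equiv> omega_form star iota \<omega>"

lemma corr_has_sum: "A \<in> Oloc loc \<Longrightarrow> B \<in> Oloc loc \<Longrightarrow> (corr A B has_sum form A B) UNIV"
  unfolding omega_form_def by (rule has_sum_infsum) (rule corr_summable)

text \<open>This is condition (II): the supports enter only through their cardinalities, which
  \<open>l\<close> bounds.\<close>

lemma form_le:
  assumes AB: "A \<in> Oloc loc" "B \<in> Oloc loc" and l: "card (supp loc A) < l" "card (supp loc B) < l"
  shows "cmod (form A B) \<le> \<nu> l * h 0 powr (1 - \<theta>) * real l * real l * total_decay * norm A * norm B"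
proof -
  let ?k = "\<nu> l * norm A * norm B * h 0 powr (1 - \<theta>)"
  have "cmod (form A B) \<le> ?k * (real (card (supp loc A)) * real (card (supp loc B)) * total_decay)"
    by (rule norm_infsum_le[OF corr_has_sum[OF AB] corr_bound_has_sum[OF AB]])
      (use corr_le_pair_decay[OF AB l] in \<open>simp add: mult.assoc\<close>)
  also have "\<dots> \<le> ?k * (real l * real l * total_decay)"
    using l by (intro mult_left_mono mult_right_mono mult_mono) (auto simp: \<nu>_nonneg total_decay_nonneg)
  finally show ?thesis by (simp add: mult_ac)
qed

lemma form_add_right:
  assumes "A \<in> Oloc loc" "B \<in> Oloc loc" "C \<in> Oloc loc"
  shows "form A (B + C) = form A B + form A C"
proof -
  have "corr A (B + C) = (\<lambda>x. corr A B x + corr A C x)"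
    by (simp add: fun_eq_iff corr_term_def state_add algebra_simps)
  then show ?thesis
    unfolding omega_form_def using assms by (simp add: infsum_add corr_summable)
qed

lemma form_add_left:
  assumes "A \<in> Oloc loc" "B \<in> Oloc loc" "C \<in> Oloc loc"
  shows "form (A + B) C = form A C + form B C"
proof -
  have "corr (A + B) C = (\<lambda>x. corr A C x + corr B C x)"
    by (simp add: fun_eq_iff corr_term_def iota_add star_add state_add algebra_simps)
  then show ?thesis
    unfolding omega_form_def using assms by (simp add: infsum_add corr_summable)
qed

lemma form_scC_right: "form A (scC c B) = c * form A B"
proof -
  have "corr A (scC c B) = (\<lambda>x. c * corr A B x)"
    by (simp add: fun_eq_iff corr_term_def state_scC scC_mult_right algebra_simps)
  then show ?thesis unfolding omega_form_def by (simp add: infsum_cmult_right')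
qed

lemma form_scC_left: "form (scC c A) B = cnj c * form A B"
proof -
  have "corr (scC c A) B = (\<lambda>x. cnj c * corr A B x)"
    by (simp add: fun_eq_iff corr_term_def iota_scC star_scC state_scC scC_mult_left algebra_simps)
  then show ?thesis unfolding omega_form_def by (simp add: infsum_cmult_right')
qed

text \<open>Translations commute with each other, so already every single term of the sum is
  invariant.\<close>

lemma form_iota: "form (iota x A) (iota x B) = form A B"
proof -
  have "corr (iota x A) (iota x B) y = corr A B y" for y
  proof -
    have "star (iota y (iota x A)) * iota x B = iota x (star (iota y A) * B)"
      by (simp add: iota_mult iota_star iota_iota add.commute)
    then show ?thesis by (simp add: corr_term_def invariant state_star_iota)
  qed
  then have "corr (iota x A) (iota x B) = corr A B" by (rule ext)
  then show ?thesis unfolding omega_form_def by simp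
qed

text \<open>An idempotent injective map is the identity.\<close>

lemma iota_0: "iota 0 a = a"
proof -
  have "iota 0 (iota 0 a) = iota 0 a" by (simp add: iota_iota)
  moreover have "inj (iota 0)" using iota_hom[of 0] bij_is_inj by blast
  ultimately show ?thesis by (simp add: inj_eq)
qed

text \<open>By invariance, replacing \<open>x\<close> by \<open>- x\<close> conjugates the term, so
  reindexing shows that the sum equals its own conjugate.\<close>

lemma Im_form_self: "Im (form A A) = 0"
proof -
  have "corr A A (- x) = cnj (corr A A x)" for x
  proof -
    have "\<omega> (star (iota (- x) A) * A) = \<omega> (iota x (star (iota (- x) A) * A))"
      by (simp add: invariant)
    also have "iota x (star (iota (- x) A) * A) = star (star (iota x A) * A)"
      by (simp add: iota_mult iota_star iota_iota iota_0 star_mult star_star)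
    finally show ?thesis by (simp add: corr_term_def state_star)
  qed
  then have "cnj (form A A) = (\<Sum>\<^sub>\<infinity>x\<in>UNIV. corr A A (- x))"
    by (simp add: omega_form_def)
  also have "\<dots> = form A A"
    unfolding omega_form_def by (rule infsum_reindex_bij_betw) (rule bij_uminus)
  finally show ?thesis by (simp add: complex_eq_iff)
qed

text \<open>The double sum of the terms at \<open>x - y\<close> over a finite \<Lambda> is the
  variance of \<open>S\<close>, the sum of the translates of \<open>A\<close> over \<Lambda>. Hence
  the terms form a positive definite function.\<close>

lemma Re_form_self_nonneg:
  assumes A: "A \<in> Oloc loc"
  shows "0 \<le> Re (form A A)"
proof -
  have "0 \<le> (\<Sum>\<^sub>\<infinity>x\<in>UNIV. Re (corr A A x))"
  proof (rule infsum_nonneg_of_positive_definite)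
    show "(\<lambda>x. Re (corr A A x)) summable_on UNIV"
      using A by (intro summable_on_Re corr_summable)
    fix \<Lambda> :: "(int^'d) set" assume "finite \<Lambda>"
    define S where "S = (\<Sum>x\<in>\<Lambda>. iota x A)"
    have corr: "corr A A (x - y) = \<omega> (star (iota x A) * iota y A) - cnj (\<omega> A) * \<omega> A" for x y
    proof -
      have "\<omega> (star (iota (x - y) A) * A) = \<omega> (iota y (star (iota (x - y) A) * A))"
        by (simp add: invariant)
      also have "iota y (star (iota (x - y) A) * A) = star (iota x A) * iota y A"
        by (simp add: iota_mult iota_star iota_iota)
      finally show ?thesis by (simp add: corr_term_def state_star)
    qed
    have "star S * S = (\<Sum>x\<in>\<Lambda>. \<Sum>y\<in>\<Lambda>. star (iota x A) * iota y A)"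
      unfolding S_def by (simp add: linear_sum[OF linear_star] sum_product)
    then have "\<omega> (star S * S) = (\<Sum>x\<in>\<Lambda>. \<Sum>y\<in>\<Lambda>. \<omega> (star (iota x A) * iota y A))"
      by (simp add: linear_sum[OF linear_state])
    moreover have "\<omega> S = of_nat (card \<Lambda>) * \<omega> A"
      unfolding S_def by (simp add: linear_sum[OF linear_state] invariant)
    ultimately have "(\<Sum>x\<in>\<Lambda>. \<Sum>y\<in>\<Lambda>. corr A A (x - y)) = \<omega> (star S * S) - cnj (\<omega> S) * \<omega> S"
      by (simp add: corr sum_subtractf mult_ac)
    then have "(\<Sum>x\<in>\<Lambda>. \<Sum>y\<in>\<Lambda>. Re (corr A A (x - y))) = Re (\<omega> (star S * S)) - Re (cnj (\<omega> S) * \<omega> S)"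
      by (simp flip: Re_sum)
    also have "Re (cnj (\<omega> S) * \<omega> S) = (cmod (\<omega> S))\<^sup>2"
      by (simp add: cmod_power2) (simp add: power2_eq_square)
    finally show "0 \<le> (\<Sum>x\<in>\<Lambda>. \<Sum>y\<in>\<Lambda>. Re (corr A A (x - y)))"
      using state_variance_nonneg[of S] by simp
  qed
  then show ?thesis
    unfolding omega_form_def using A by (simp add: infsum_Re corr_summable)
qed

section \<open>The Leibniz-type estimate\<close>

text \<open>The left-hand side of condition (I) at one translation: the cancellation takes place
  before the sum over \<open>x\<close>.\<close>

definition leibniz_defect :: "'a \<Rightarrow> 'a \<Rightarrow> 'a \<Rightarrow> int^'d \<Rightarrow> complex" where
  "leibniz_defect A B C x = corr A (B * C) x - corr A B x * \<omega> C - corr A C x * \<omega> B"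

text \<open>The three terms are bounded separately, which gives the factor 3. The support of
  \<open>B * C\<close> can have almost \<open>2 * l\<close> points, hence the doubled index of
  \<nu>.\<close>

lemma leibniz_defect_le_near:
  assumes ABC: "A \<in> Oloc loc" "B \<in> Oloc loc" "C \<in> Oloc loc"
    and l: "card (supp loc A) < l" "card (supp loc B) < l" "card (supp loc C) < l"
    and d: "0 \<le> d" "\<And>a b. a \<in> supp loc A \<Longrightarrow> b \<in> supp loc B \<union> supp loc C \<Longrightarrow> d \<le> real_of_int (ldist (a + x) b)"
  shows "cmod (leibniz_defect A B C x) \<le> 3 * (\<nu> (2 * l) * norm A * norm B * norm C) * h d"
proof -
  let ?N = "\<nu> (2 * l) * norm A * norm B * norm C"
  have BC: "B * C \<in> Oloc loc" using ABC by (intro Oloc_mult)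
  have sBC: "supp loc (B * C) \<subseteq> supp loc B \<union> supp loc C" using ABC by (intro supp_mult_subset)
  have "card (supp loc (B * C)) \<le> card (supp loc B) + card (supp loc C)"
    using card_mono[OF _ sBC] card_Un_le[of "supp loc B" "supp loc C"] ABC finite_supp by fastforce
  then have "cmod (corr A (B * C) x) \<le> \<nu> (2 * l) * norm A * norm (B * C) * h d"
    using sBC l d by (intro corr_le ABC BC) auto
  also have "\<dots> \<le> \<nu> (2 * l) * norm A * (norm B * norm C) * h d"
    by (intro mult_right_mono mult_left_mono norm_mult_ineq) (simp_all add: \<nu>_nonneg h_nonneg)
  finally have 1: "cmod (corr A (B * C) x) \<le> ?N * h d" by (simp add: mult_ac)
  have "cmod (corr A B x) \<le> \<nu> (2 * l) * norm A * norm B * h d"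
    using l d by (intro corr_le ABC) auto
  then have "cmod (corr A B x) * cmod (\<omega> C) \<le> \<nu> (2 * l) * norm A * norm B * h d * norm C"
    by (intro mult_mono state_norm_le ABC) (simp_all add: \<nu>_nonneg h_nonneg)
  then have 2: "cmod (corr A B x * \<omega> C) \<le> ?N * h d" by (simp add: norm_mult mult_ac)
  have "cmod (corr A C x) \<le> \<nu> (2 * l) * norm A * norm C * h d"
    using l d by (intro corr_le ABC) auto
  then have "cmod (corr A C x) * cmod (\<omega> B) \<le> \<nu> (2 * l) * norm A * norm C * h d * norm B"
    by (intro mult_mono state_norm_le ABC) (simp_all add: \<nu>_nonneg h_nonneg)
  then have 3: "cmod (corr A C x * \<omega> B) \<le> ?N * h d" by (simp add: norm_mult mult_ac)
  have "cmod (leibniz_defect A B C x) \<le> cmod (corr A (B * C) x) + cmod (corr A B x * \<omega> C) + cmod (corr A C x * \<omega> B)"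
    unfolding leibniz_defect_def by (rule norm_diff_diff_le)
  then show ?thesis using 1 2 3 by linarith
qed

text \<open>If \<open>C\<close> is far from both \<open>A\<^sub>x\<close> and \<open>B\<close>, then regroup the defect as
  \<open>[\<omega>(a B C) - \<omega>(a B) \<omega>(C)] - \<omega>(a) [\<omega>(B C) - \<omega>(B) \<omega>(C)] - [\<omega>(a C) - \<omega>(a) \<omega>(C)] \<omega>(B)\<close>
  with \<open>a = A\<^sub>x\<^sup>*\<close>.\<close>

lemma leibniz_defect_le_far_right:
  assumes ABC: "A \<in> Oloc loc" "B \<in> Oloc loc" "C \<in> Oloc loc"
    and l: "card (supp loc A) < l" "card (supp loc B) < l" "card (supp loc C) < l"
    and d: "0 \<le> d" "\<And>a c. a \<in> supp loc A \<Longrightarrow> c \<in> supp loc C \<Longrightarrow> d \<le> real_of_int (ldist (a + x) c)"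
      "\<And>b c. b \<in> supp loc B \<Longrightarrow> c \<in> supp loc C \<Longrightarrow> d \<le> real_of_int (ldist b c)"
  shows "cmod (leibniz_defect A B C x) \<le> 3 * (\<nu> (2 * l) * norm A * norm B * norm C) * h d"
proof -
  let ?N = "\<nu> (2 * l) * norm A * norm B * norm C"
  define a where "a = star (iota x A)"
  have a: "a \<in> Oloc loc" "supp loc a = (\<lambda>z. z + x) ` supp loc A" "card (supp loc a) = card (supp loc A)"
      "norm a \<le> norm A"
    unfolding a_def using star_iota[OF ABC(1), of x] by blast+
  have aB: "a * B \<in> Oloc loc" using ABC a by (intro Oloc_mult)
  have saB: "supp loc (a * B) \<subseteq> supp loc a \<union> supp loc B" using ABC a by (intro supp_mult_subset)
  \<comment> \<open>The first bracket treats \<open>a * B\<close> as one observable, whose support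
    again has fewer than \<open>2 * l\<close> points.\<close>
  have "card (supp loc (a * B)) \<le> card (supp loc a) + card (supp loc B)"
    using card_mono[OF _ saB] card_Un_le[of "supp loc a" "supp loc B"] ABC a finite_supp by fastforce
  then have "cmod (\<omega> (a * B * C) - \<omega> (a * B) * \<omega> C) \<le> \<nu> (2 * l) * norm (a * B) * norm C * h d"
    using saB l d a by (intro clustering_le ABC aB) auto
  also have "\<dots> \<le> \<nu> (2 * l) * (norm A * norm B) * norm C * h d"
  proof -
    have "norm (a * B) \<le> norm a * norm B" by (rule norm_mult_ineq)
    also have "\<dots> \<le> norm A * norm B" using a by (intro mult_right_mono) auto
    finally show ?thesis
      by (intro mult_right_mono mult_left_mono) (simp_all add: \<nu>_nonneg h_nonneg)
  qed
  finally have 1: "cmod (\<omega> (a * B * C) - \<omega> (a * B) * \<omega> C) \<le> ?N * h d" by (simp add: mult_ac)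
  have "cmod (\<omega> (B * C) - \<omega> B * \<omega> C) \<le> \<nu> (2 * l) * norm B * norm C * h d"
    using l d by (intro clustering_le ABC) auto
  moreover have "cmod (\<omega> a) \<le> norm A" using state_norm_le[OF a(1)] a(4) by linarith
  ultimately have "cmod (\<omega> a) * cmod (\<omega> (B * C) - \<omega> B * \<omega> C) \<le> norm A * (\<nu> (2 * l) * norm B * norm C * h d)"
    by (intro mult_mono) auto
  then have 2: "cmod (\<omega> a * (\<omega> (B * C) - \<omega> B * \<omega> C)) \<le> ?N * h d" by (simp add: norm_mult mult_ac)
  have "cmod (corr A C x) \<le> \<nu> (2 * l) * norm A * norm C * h d"
    using l d by (intro corr_le ABC) auto
  then have "cmod (corr A C x) * cmod (\<omega> B) \<le> \<nu> (2 * l) * norm A * norm C * h d * norm B"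
    by (intro mult_mono state_norm_le ABC) (simp_all add: \<nu>_nonneg h_nonneg)
  then have 3: "cmod (corr A C x * \<omega> B) \<le> ?N * h d" by (simp add: norm_mult mult_ac)
  have \<omega>a: "\<omega> (star A) = \<omega> a" by (simp add: a_def state_star_iota)
  have "leibniz_defect A B C x = (\<omega> (a * B * C) - \<omega> (a * B) * \<omega> C)
      - \<omega> a * (\<omega> (B * C) - \<omega> B * \<omega> C) - corr A C x * \<omega> B"
    unfolding leibniz_defect_def corr_term_def \<omega>a a_def[symmetric] by (simp add: algebra_simps)
  then have "cmod (leibniz_defect A B C x) \<le> cmod (\<omega> (a * B * C) - \<omega> (a * B) * \<omega> C)
      + cmod (\<omega> a * (\<omega> (B * C) - \<omega> B * \<omega> C)) + cmod (corr A C x * \<omega> B)"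
    by (simp only: norm_diff_diff_le)
  then show ?thesis using 1 2 3 by linarith
qed

text \<open>Either the translate of \<open>A\<close> keeps distance \<open>e / 2\<close> from
  \<open>C\<close>, or it is near \<open>C\<close> and therefore at least that far from
  \<open>B\<close>. In the second case \<open>B\<close> and \<open>C\<close> exchange roles.\<close>

lemma leibniz_defect_le_far:
  assumes ABC: "A \<in> Oloc loc" "B \<in> Oloc loc" "C \<in> Oloc loc"
    and l: "card (supp loc A) < l" "card (supp loc B) < l" "card (supp loc C) < l"
    and r: "sdist loc B C = Some r"
  shows "cmod (leibniz_defect A B C x) \<le> 3 * (\<nu> (2 * l) * norm A * norm B * norm C)
      * h (real_of_int (max 0 (r - sdiam loc A)) / 2)"
proof (cases "r \<le> sdiam loc A")
  case True
  \<comment> \<open>Without separation the claimed decay factor is \<open>h 0\<close>, which the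
    near bound gives with \<open>d = 0\<close>.\<close>
  have "cmod (leibniz_defect A B C x) \<le> 3 * (\<nu> (2 * l) * norm A * norm B * norm C) * h 0"
    by (intro leibniz_defect_le_near ABC l) (simp_all add: ldist_nonneg)
  then show ?thesis using True by simp
next
  case False
  note fin = ABC[THEN finite_supp]
  define e where "e = r - sdiam loc A"
  have e: "e > 0" using False by (simp add: e_def)
  have diam: "0 \<le> sdiam loc A" by (rule sdiam_nonneg[OF fin(1)])
  have r_le: "r \<le> ldist b c" if "b \<in> supp loc B" "c \<in> supp loc C" for b c
    using sdist_le_ldist[OF r fin(2,3) that] .
  have e_le: "real_of_int e / 2 \<le> real_of_int (ldist b c)" if "b \<in> supp loc B" "c \<in> supp loc C" for b c
  proof -
    have "e \<le> ldist b c" using r_le[OF that] diam by (simp add: e_def)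
    then have "real_of_int e \<le> real_of_int (ldist b c)" by simp
    then show ?thesis using e by simp
  qed
  \<comment> \<open>Positive \<open>e\<close> forces disjoint supports, so \<open>B\<close> and
    \<open>C\<close> commute and the defect is symmetric in them.\<close>
  have "supp loc B \<inter> supp loc C = {}"
  proof (rule ccontr)
    assume "supp loc B \<inter> supp loc C \<noteq> {}"
    then obtain b where "b \<in> supp loc B" "b \<in> supp loc C" by blast
    from r_le[OF this] have "r \<le> 0" by (simp add: ldist_eq_0_iff[THEN iffD2])
    then show False using e diam by (simp add: e_def)
  qed
  then have comm: "B * C = C * B" using ABC by (intro commute_if_disjoint_supp)
  have sym: "leibniz_defect A B C x = leibniz_defect A C B x"
    by (simp add: leibniz_defect_def comm)
  have "cmod (leibniz_defect A B C x) \<le> 3 * (\<nu> (2 * l) * norm A * norm B * norm C) * h (real_of_int e / 2)"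
  proof (cases "\<forall>a\<in>supp loc A. \<forall>c\<in>supp loc C. real_of_int e / 2 \<le> real_of_int (ldist (a + x) c)")
    case True
    then show ?thesis using e e_le by (intro leibniz_defect_le_far_right ABC l) auto
  next
    case False
    then obtain a c where ac: "a \<in> supp loc A" "c \<in> supp loc C"
      and near: "real_of_int (ldist (a + x) c) < real_of_int e / 2" by (auto simp: not_le)
    \<comment> \<open>The way from \<open>b\<close> to \<open>c\<close> passes through
      \<open>a' + x\<close> and \<open>a + x\<close>. The middle leg costs at most the diameter of
      \<open>A\<close> and the last one less than \<open>e / 2\<close>.\<close>
    have far: "real_of_int e / 2 \<le> real_of_int (ldist (a' + x) b)" if "a' \<in> supp loc A" "b \<in> supp loc B" for a' b
    proof -
      have "r \<le> ldist b c" using r_le that ac by blast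
      also have "\<dots> \<le> ldist b (a' + x) + ldist (a' + x) c" by (rule ldist_triangle)
      also have "ldist (a' + x) c \<le> ldist (a' + x) (a + x) + ldist (a + x) c" by (rule ldist_triangle)
      also have "ldist (a' + x) (a + x) = ldist a' a" by (rule ldist_add_right)
      also have "ldist a' a \<le> sdiam loc A" using fin that ac by (intro ldist_le_sdiam) auto
      also have "ldist b (a' + x) = ldist (a' + x) b" by (rule ldist_commute)
      finally have "e \<le> ldist (a' + x) b + ldist (a + x) c" by (simp add: e_def)
      then have "real_of_int e \<le> real_of_int (ldist (a' + x) b) + real_of_int (ldist (a + x) c)"
        by linarith
      then show ?thesis using near by linarith
    qed
    have "cmod (leibniz_defect A C B x) \<le> 3 * (\<nu> (2 * l) * norm A * norm C * norm B) * h (real_of_int e / 2)"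
    proof (intro leibniz_defect_le_far_right ABC l)
      show "real_of_int e / 2 \<le> real_of_int (ldist c b)" if "c \<in> supp loc C" "b \<in> supp loc B" for c b
        using e_le[OF that(2,1)] by (simp only: ldist_commute)
    qed (use e far in auto)
    then show ?thesis unfolding sym by (simp add: mult_ac)
  qed
  then show ?thesis using e by (simp add: e_def)
qed

text \<open>The far bound \<open>u\<close> is uniform in \<open>x\<close>, the near bound
  \<open>v\<close> decays in \<open>x\<close>. Interpolation keeps the power
  \<open>1 - \<theta>\<close> of \<open>u\<close> as decay in the separation and the power \<theta>
  of \<open>v\<close> for the summation.\<close>

lemma leibniz_defect_le:
  assumes ABC: "A \<in> Oloc loc" "B \<in> Oloc loc" "C \<in> Oloc loc"
    and l: "card (supp loc A) < l" "card (supp loc B) < l" "card (supp loc C) < l"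
    and r: "sdist loc B C = Some r"
  shows "cmod (leibniz_defect A B C x) \<le> 3 * (\<nu> (2 * l) * norm A * norm B * norm C)
      * h (real_of_int (max 0 (r - sdiam loc A)) / 2) powr (1 - \<theta>)
      * pair_decay (supp loc A) (supp loc B \<union> supp loc C) x"
proof (cases "supp loc A = {}")
  case True
  then have "leibniz_defect A B C x = 0"
    unfolding leibniz_defect_def using ABC by (simp add: corr_eq_0_if_supp_empty Oloc_mult)
  then show ?thesis by (simp add: \<nu>_nonneg pair_decay_nonneg)
next
  case False
  note fin = ABC[THEN finite_supp]
  let ?N = "3 * (\<nu> (2 * l) * norm A * norm B * norm C)"
  define u where "u = h (real_of_int (max 0 (r - sdiam loc A)) / 2)"
  have "supp loc B \<union> supp loc C \<noteq> {}" using r by (auto simp: sdist_def split: if_splits)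
  then obtain a b where ab: "a \<in> supp loc A" "b \<in> supp loc B \<union> supp loc C"
    and min: "\<And>a' b'. a' \<in> supp loc A \<Longrightarrow> b' \<in> supp loc B \<union> supp loc C \<Longrightarrow> ldist (a + x) b \<le> ldist (a' + x) b'"
    using exists_nearest_pair[of "supp loc A" "supp loc B \<union> supp loc C" x] False fin by blast
  define v where "v = h (real_of_int (ldist (a + x) b))"
  have N: "0 \<le> ?N" by (simp add: \<nu>_nonneg)
  have 1: "cmod (leibniz_defect A B C x) \<le> ?N * u"
    unfolding u_def by (rule leibniz_defect_le_far[OF ABC l r])
  have 2: "cmod (leibniz_defect A B C x) \<le> ?N * v"
    unfolding v_def using min by (intro leibniz_defect_le_near ABC l) (auto simp: ldist_nonneg)
  have "cmod (leibniz_defect A B C x) \<le> ?N * min u v"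
    using 1 2 by (simp add: min_def)
  also have "\<dots> \<le> ?N * (u powr (1 - \<theta>) * v powr \<theta>)"
    using \<theta> by (intro mult_left_mono N le_powr_interpolate) (auto simp: u_def v_def h_nonneg)
  also have "\<dots> \<le> ?N * (u powr (1 - \<theta>) * pair_decay (supp loc A) (supp loc B \<union> supp loc C) x)"
    unfolding v_def using fin ab by (intro mult_left_mono N le_pair_decay) auto
  finally show ?thesis by (simp add: u_def mult_ac)
qed

lemma form_leibniz_defect_le:
  assumes ABC: "A \<in> Oloc loc" "B \<in> Oloc loc" "C \<in> Oloc loc"
    and l: "card (supp loc A) < l" "card (supp loc B) < l" "card (supp loc C) < l"
    and r: "sdist loc B C = Some r"
  shows "cmod (form A (B * C) - form A B * \<omega> C - form A C * \<omega> B)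
    \<le> 6 * \<nu> (2 * l) * real l * real l * total_decay * norm A * norm B * norm C
      * h (real_of_int (max 0 (r - sdiam loc A)) / 2) powr (1 - \<theta>)"
proof -
  note fin = ABC[THEN finite_supp]
  let ?k = "3 * (\<nu> (2 * l) * norm A * norm B * norm C)
      * h (real_of_int (max 0 (r - sdiam loc A)) / 2) powr (1 - \<theta>)"
  let ?YZ = "supp loc B \<union> supp loc C"
  have "(corr A (B * C) has_sum form A (B * C)) UNIV" using ABC by (intro corr_has_sum Oloc_mult)
  moreover have "((\<lambda>x. corr A B x * - \<omega> C) has_sum (form A B * - \<omega> C)) UNIV"
    using ABC by (intro has_sum_cmult_left corr_has_sum)
  moreover have "((\<lambda>x. corr A C x * - \<omega> B) has_sum (form A C * - \<omega> B)) UNIV"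
    using ABC by (intro has_sum_cmult_left corr_has_sum)
  ultimately have "((\<lambda>x. corr A (B * C) x + corr A B x * - \<omega> C + corr A C x * - \<omega> B) has_sum
      (form A (B * C) + form A B * - \<omega> C + form A C * - \<omega> B)) UNIV"
    by (intro has_sum_add)
  then have "(leibniz_defect A B C has_sum
      (form A (B * C) - form A B * \<omega> C - form A C * \<omega> B)) UNIV"
    by (simp add: leibniz_defect_def[abs_def])
  moreover have "((\<lambda>x. ?k * pair_decay (supp loc A) ?YZ x) has_sum
      (?k * (real (card (supp loc A)) * real (card ?YZ) * total_decay))) UNIV"
    using fin by (intro has_sum_cmult_right pair_decay_has_sum) auto
  ultimately have "cmod (form A (B * C) - form A B * \<omega> C - form A C * \<omega> B)
      \<le> ?k * (real (card (supp loc A)) * real (card ?YZ) * total_decay)"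
    by (rule norm_infsum_le) (rule leibniz_defect_le[OF ABC l r])
  \<comment> \<open>The union of the two supports has at most \<open>2 * real l\<close> points;
    together with the factor 3 of the defect this makes the constant 6.\<close>
  also have "\<dots> \<le> ?k * (real l * (2 * real l) * total_decay)"
  proof (intro mult_left_mono mult_right_mono mult_mono)
    show "real (card ?YZ) \<le> 2 * real l" using card_Un_le[of "supp loc B" "supp loc C"] l by linarith
  qed (use l in \<open>auto simp: \<nu>_nonneg total_decay_nonneg\<close>)
  finally show ?thesis by (simp add: mult_ac)
qed

text \<open>At infinite distance \<open>fb\<close> is 0, so the defect must vanish exactly. One of
  \<open>B\<close> and \<open>C\<close> is then a scalar, and the form vanishes on scalars in its
  second argument.\<close>

lemma form_leibniz_defect_eq_0:
  assumes ABC: "A \<in> Oloc loc" "B \<in> Oloc loc" "C \<in> Oloc loc" and "sdist loc B C = None"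
  shows "form A (B * C) - form A B * \<omega> C - form A C * \<omega> B = 0"
proof -
  have one: "form A 1 = 0"
    using corr_scalar_right[of A 1] by (simp add: omega_form_def scC_one)
  have "supp loc B = {} \<or> supp loc C = {}" using assms(4) by (simp add: sdist_def split: if_splits)
  then show ?thesis
  proof
    assume "supp loc B = {}"
    then obtain c where "B = scC c 1" using scalar_if_supp_empty[OF ABC(2)] by blast
    then show ?thesis by (simp add: one scC_mult_left form_scC_right state_scC state_one)
  next
    assume "supp loc C = {}"
    then obtain c where "C = scC c 1" using scalar_if_supp_empty[OF ABC(3)] by blast
    then show ?thesis by (simp add: one scC_mult_right form_scC_right state_scC state_one)
  qed
qed

lemma clustering_form_omega_form:
  assumes c: "c > 0" "\<And>d::int. d > 0 \<Longrightarrow> h (real_of_int d / 2) powr (1 - \<theta>) \<le> c * g d"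
  shows "clustering_form scC star loc iota g \<omega> form"
proof -
  \<comment> \<open>The decay function must lie below \<open>g\<close> itself, so the constant
    \<open>c\<close> is moved into the prefactor. The \<open>max\<close> in \<open>f'\<close> covers
    separations smaller than the diameter of \<open>A\<close>.\<close>
  define \<nu>' where "\<nu>' = (\<lambda>l. 6 * \<nu> (2 * l) * real l * real l * total_decay * c)"
  define f' where "f' = (\<lambda>d::int. h (real_of_int (max 0 d) / 2) powr (1 - \<theta>) / c)"
  have leibniz: "cmod (form A (B * C) - form A B * \<omega> C - form A C * \<omega> B)
      \<le> \<nu>' l * norm A * norm B * norm C * fb f' (map_option (\<lambda>d. d - sdiam loc A) (sdist loc B C))"
    if ABC: "A \<in> Oloc loc" "B \<in> Oloc loc" "C \<in> Oloc loc"
      and l: "card (supp loc A) < l" "card (supp loc B) < l" "card (supp loc C) < l" for l A B C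
  proof (cases "sdist loc B C")
    case None
    then show ?thesis using form_leibniz_defect_eq_0[OF ABC] by (simp add: fb_def)
  next
    case (Some r)
    then show ?thesis
      using form_leibniz_defect_le[OF ABC l Some] c(1) by (simp add: fb_def \<nu>'_def f'_def mult_ac)
  qed
  have bounded: "\<exists>\<kappa>>0. \<forall>A\<in>Oloc loc. \<forall>B\<in>Oloc loc.
        card (supp loc A) < l \<longrightarrow> card (supp loc B) < l \<longrightarrow>
        cmod (form A B) \<le> \<kappa> * norm A * norm B" for l
  proof -
    define k where "k = \<nu> l * h 0 powr (1 - \<theta>) * real l * real l * total_decay"
    have k: "0 \<le> k" by (simp add: k_def \<nu>_nonneg total_decay_nonneg)
    \<comment> \<open>The constant in (II) must be strictly positive while \<open>k\<close> may be
      0, hence \<open>k + 1\<close>.\<close>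
    have "cmod (form A B) \<le> (k + 1) * norm A * norm B"
      if "A \<in> Oloc loc" "B \<in> Oloc loc" "card (supp loc A) < l" "card (supp loc B) < l" for A B
    proof -
      have "cmod (form A B) \<le> k * norm A * norm B" unfolding k_def by (rule form_le[OF that])
      also have "\<dots> \<le> (k + 1) * norm A * norm B" by (intro mult_right_mono) auto
      finally show ?thesis .
    qed
    then show ?thesis using k by (intro exI[of _ "k + 1"]) auto
  qed
  have "\<exists>(\<nu>::nat \<Rightarrow> real) (f::int \<Rightarrow> real). (\<forall>n. \<nu> n \<ge> 0) \<and> (\<forall>d. f d \<ge> 0) \<and>
        (\<forall>d>0. f d \<le> g d) \<and>
        (\<forall>l A B C. A \<in> Oloc loc \<longrightarrow> B \<in> Oloc loc \<longrightarrow> C \<in> Oloc loc \<longrightarrow>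
           card (supp loc A) < l \<longrightarrow> card (supp loc B) < l \<longrightarrow> card (supp loc C) < l \<longrightarrow>
           cmod (form A (B * C) - form A B * \<omega> C - form A C * \<omega> B)
             \<le> \<nu> l * norm A * norm B * norm C *
                fb f (map_option (\<lambda>d. d - sdiam loc A) (sdist loc B C)))"
  proof (intro exI[of _ \<nu>'] exI[of _ f'] conjI allI impI)
    show "0 \<le> \<nu>' n" for n using c(1) by (simp add: \<nu>'_def \<nu>_nonneg total_decay_nonneg)
    show "0 \<le> f' d" for d using c(1) by (simp add: f'_def)
    show "f' d \<le> g d" if "d > 0" for d
      using c(2)[OF that] c(1) that by (simp add: f'_def field_simps)
  qed (rule leibniz)
  then show ?thesis
    unfolding clustering_form_def
    using bounded
    by (intro conjI ballI allI impI)
      (simp_all only: form_add_right form_add_left form_scC_right form_scC_left form_iota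
        Im_form_self Re_form_self_nonneg)
qed

end

section \<open>Algebraic and exponential rates\<close>

text \<open>This reduces both cases to a choice of \<open>h\<close> and \<theta>, with the given
  rates compared to \<open>h\<close> only up to constants.\<close>

lemma clustering_form_of_dominated:
  fixes loc :: "(int ^ 'd) set \<Rightarrow> 'a::{real_normed_algebra_1,banach} set"
  assumes ql: "quasi_local scC star loc iota"
    and cl: "clustering_state scC star loc iota g \<omega>"
    and h: "\<And>t. 0 \<le> h t" "\<And>s t. 0 \<le> s \<Longrightarrow> s \<le> t \<Longrightarrow> h t \<le> h s"
      "0 < h 0" "\<And>d::int. d > 0 \<Longrightarrow> g d \<le> K * h (real_of_int d)"
    and \<theta>: "0 < \<theta>" "\<theta> < 1"
    and summable: "(\<lambda>x::int^'d. h (real_of_int (ldist x 0)) powr \<theta>) summable_on UNIV"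
    and g': "c > 0" "\<And>d::int. d > 0 \<Longrightarrow> h (real_of_int d / 2) powr (1 - \<theta>) \<le> c * g' d"
  shows "(\<forall>A\<in>Oloc loc. \<forall>B\<in>Oloc loc. corr_term star iota \<omega> A B summable_on UNIV) \<and>
    clustering_form scC star loc iota g' \<omega> (omega_form star iota \<omega>)"
proof -
  obtain \<nu> f where \<nu>: "\<And>n. \<nu> n \<ge> (0::real)" and f: "\<And>d::int. f d \<ge> (0::real)" "\<And>d. d > 0 \<Longrightarrow> f d \<le> g d"
    and clust: "\<And>l A B. A \<in> Oloc loc \<Longrightarrow> B \<in> Oloc loc \<Longrightarrow>
           card (supp loc A) < l \<Longrightarrow> card (supp loc B) < l \<Longrightarrow>
           cmod (\<omega> (A * B) - \<omega> A * \<omega> B) \<le> \<nu> l * norm A * norm B * fb f (sdist loc A B)"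
    using cl unfolding clustering_state_def by blast
  \<comment> \<open>The rate \<open>g\<close> says nothing about distance 0, so \<open>M\<close> has
    to absorb \<open>f 0\<close> as well as \<open>K\<close>; being at least 1 it stays
    positive.\<close>
  define M where "M = max 1 (max K (f 0 / h 0))"
  have M: "M \<ge> 1" "K \<le> M" "f 0 / h 0 \<le> M" by (simp_all add: M_def)
  have fM: "f 0 \<le> M * h 0" using M(3) h(3) by (simp add: field_simps)
  have Mpos: "M powr (1 - \<theta>) > 0" using M by simp
  interpret dominated_clustering scC star loc iota \<omega> \<nu> f "\<lambda>t. M * h t" \<theta>
  proof
    show "quasi_local scC star loc iota" by (rule ql)
    show "is_state scC star \<omega>" "\<omega> (iota x a) = \<omega> a" for x a
      using cl unfolding clustering_state_def by blast+
    show "f d \<le> M * h (real_of_int d)" if "0 \<le> d" for d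
    proof (cases "d = 0")
      case False
      then have "f d \<le> K * h (real_of_int d)" using that f(2)[of d] h(4)[of d] by simp
      also have "\<dots> \<le> M * h (real_of_int d)" using M h(1) by (intro mult_right_mono) auto
      finally show ?thesis .
    qed (use fM in simp)
    show "(\<lambda>x::int^'d. (M * h (real_of_int (ldist x 0))) powr \<theta>) summable_on UNIV"
      using summable_on_cmult_right[OF summable, of "M powr \<theta>"] M h(1) by (simp add: powr_mult)
  qed (use \<nu> \<theta> clust M h in \<open>auto intro: mult_left_mono\<close>)
  have "clustering_form scC star loc iota g' \<omega> (omega_form star iota \<omega>)"
  proof (rule clustering_form_omega_form)
    show "0 < M powr (1 - \<theta>) * c" using Mpos g'(1) by simp
    show "(M * h (real_of_int d / 2)) powr (1 - \<theta>) \<le> M powr (1 - \<theta>) * c * g' d" if "d > 0" for d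
      using mult_left_mono[OF g'(2)[OF that], of "M powr (1 - \<theta>)"] Mpos M h(1)
      by (simp add: powr_mult mult_ac)
  qed
  then show ?thesis using corr_summable by blast
qed

text \<open>With \<open>\<theta> = (p - q) / p\<close>, the summed power of \<open>h\<close> has
  exponent \<open>p - q\<close>, which exceeds the dimension, and the remaining power has exponent
  \<open>q\<close>. The shift by 1 keeps \<open>h\<close> antitone at 0, where \<open>powr\<close>
  with base 0 would return 0.\<close>

lemma alg_clustering_form_omega_form:
  fixes loc :: "(int ^ 'd) set \<Rightarrow> 'a::{real_normed_algebra_1,banach} set"
  assumes ql: "quasi_local scC star loc iota"
    and cl: "alg_clustering_state scC star loc iota p \<omega>"
    and q: "real CARD('d) < q" "q < p - real CARD('d)"
  shows "(\<forall>A\<in>Oloc loc. \<forall>B\<in>Oloc loc. corr_term star iota \<omega> A B summable_on UNIV) \<and>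
    alg_clustering_form scC star loc iota q \<omega> (omega_form star iota \<omega>)"
  unfolding alg_clustering_form_def
proof (rule clustering_form_of_dominated[OF ql, where h = "\<lambda>t. (1 + max 0 t) powr (- p)"
      and \<theta> = "(p - q) / p" and K = "2 powr p" and c = "2 powr q"])
  show "clustering_state scC star loc iota (\<lambda>d. real_of_int d powr (- p)) \<omega>"
    using cl by (simp add: alg_clustering_state_def)
  have pos: "0 < q" "q < p" "0 < p" using q by auto
  show "(1 + max 0 t) powr - p \<le> (1 + max 0 s) powr - p" if "0 \<le> s" "s \<le> t" for s t :: real
    using pos that by (intro powr_mono2') auto
  \<comment> \<open>For integers \<open>d \<ge> 1\<close> one has \<open>1 + d \<le> 2 * d\<close>,
    whence the constant \<open>2 powr p\<close>.\<close>
  show "real_of_int d powr - p \<le> 2 powr p * (1 + max 0 (real_of_int d)) powr - p" if "0 < d" for d :: int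
  proof -
    have "real_of_int d powr - p = 2 powr p * (2 * real_of_int d) powr - p"
      using that by (simp add: powr_mult powr_minus field_simps)
    also have "\<dots> \<le> 2 powr p * (1 + max 0 (real_of_int d)) powr - p"
      using that pos by (intro mult_left_mono powr_mono2') auto
    finally show ?thesis .
  qed
  show "0 < (p - q) / p" "(p - q) / p < 1" using pos by (simp_all add: field_simps)
  have "- p * ((p - q) / p) = - (p - q)" using pos by simp
  then have "((1 + max 0 (real_of_int (ldist x 0))) powr - p) powr ((p - q) / p)
      = (1 + real_of_int (ldist x 0)) powr - (p - q)" for x :: "int^'d"
    by (simp add: powr_powr ldist_nonneg max_def)
  then show "(\<lambda>x::int^'d. ((1 + max 0 (real_of_int (ldist x 0))) powr - p) powr ((p - q) / p)) summable_on UNIV"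
    using summable_on_vec_powr[where 'd = 'd and s = "p - q"] q by simp
  show "((1 + max 0 (real_of_int d / 2)) powr - p) powr (1 - (p - q) / p) \<le> 2 powr q * real_of_int d powr - q"
    if "0 < d" for d :: int
  proof -
    have "- p * (1 - (p - q) / p) = - q" using pos by (simp add: field_simps)
    then have "((1 + max 0 (real_of_int d / 2)) powr - p) powr (1 - (p - q) / p)
        = (1 + real_of_int d / 2) powr - q" using that by (simp add: powr_powr max_def)
    also have "\<dots> \<le> (real_of_int d / 2) powr - q" using that pos by (intro powr_mono2') auto
    also have "\<dots> = 2 powr q * real_of_int d powr - q"
      using that by (simp add: powr_divide powr_minus field_simps)
    finally show ?thesis .
  qed
qed auto

text \<open>The remaining power \<open>1 - \<theta> = 2 * \<beta> / \<alpha>\<close> at half the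
  distance gives exactly the rate \<beta>, and the summed power has the positive rate
  \<open>\<alpha> - 2 * \<beta>\<close>. Halving the distance is what limits \<beta> to
  \<open>\<alpha> / 2\<close>.\<close>

lemma exp_clustering_form_omega_form:
  fixes loc :: "(int ^ 'd) set \<Rightarrow> 'a::{real_normed_algebra_1,banach} set"
  assumes ql: "quasi_local scC star loc iota"
    and cl: "exp_clustering_state scC star loc iota \<alpha> \<omega>"
    and \<beta>: "0 < \<beta>" "\<beta> < \<alpha> / 2"
  shows "(\<forall>A\<in>Oloc loc. \<forall>B\<in>Oloc loc. corr_term star iota \<omega> A B summable_on UNIV) \<and>
    exp_clustering_form scC star loc iota \<beta> \<omega> (omega_form star iota \<omega>)"
  unfolding exp_clustering_form_def
proof (rule clustering_form_of_dominated[OF ql, where h = "\<lambda>t. exp (- \<alpha> * t)"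
      and \<theta> = "1 - 2 * \<beta> / \<alpha>" and K = 1 and c = 1])
  show "clustering_state scC star loc iota (\<lambda>d. exp (- \<alpha> * real_of_int d)) \<omega>"
    using cl by (simp add: exp_clustering_state_def)
  have \<alpha>: "0 < \<alpha>" using \<beta> by simp
  show "exp (- \<alpha> * t) \<le> exp (- \<alpha> * s)" if "0 \<le> s" "s \<le> t" for s t
    using \<alpha> that by simp
  show \<theta>: "0 < 1 - 2 * \<beta> / \<alpha>" "1 - 2 * \<beta> / \<alpha> < 1" using \<alpha> \<beta> by (simp_all add: field_simps)
  show "(\<lambda>x::int^'d. exp (- \<alpha> * real_of_int (ldist x 0)) powr (1 - 2 * \<beta> / \<alpha>)) summable_on UNIV"
    using summable_on_vec_exp[where 'd = 'd and s = "\<alpha> * (1 - 2 * \<beta> / \<alpha>)"] \<alpha> \<theta>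
    by (simp add: exp_powr_real mult_ac)
  show "exp (- \<alpha> * (real_of_int d / 2)) powr (1 - (1 - 2 * \<beta> / \<alpha>)) \<le> 1 * exp (- \<beta> * real_of_int d)"
    if "0 < d" for d :: int
    using \<alpha> by (simp add: exp_powr_real)
qed auto

theorem theorem4p9:
  fixes scC :: "complex \<Rightarrow> 'a::{real_normed_algebra_1,banach} \<Rightarrow> 'a"
    and star :: "'a \<Rightarrow> 'a"
    and loc :: "(int ^ 'd) set \<Rightarrow> 'a set"
    and iota :: "int ^ 'd \<Rightarrow> 'a \<Rightarrow> 'a"
    and \<omega> :: "'a \<Rightarrow> complex"
    and p \<alpha> :: real
  assumes "quasi_local scC star loc iota"
  shows "(alg_clustering_state scC star loc iota p \<omega> \<and> p > 2 * real CARD('d) \<longrightarrow>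
            (\<forall>A\<in>Oloc loc. \<forall>B\<in>Oloc loc. corr_term star iota \<omega> A B summable_on UNIV) \<and>
            (\<forall>q. real CARD('d) < q \<and> q < p - real CARD('d) \<longrightarrow>
               alg_clustering_form scC star loc iota q \<omega> (omega_form star iota \<omega>)))
       \<and> (exp_clustering_state scC star loc iota \<alpha> \<omega> \<and> \<alpha> > 0 \<longrightarrow>
            (\<forall>A\<in>Oloc loc. \<forall>B\<in>Oloc loc. corr_term star iota \<omega> A B summable_on UNIV) \<and>
            (\<forall>\<beta>. 0 < \<beta> \<and> \<beta> < \<alpha> / 2 \<longrightarrow>
               exp_clustering_form scC star loc iota \<beta> \<omega> (omega_form star iota \<omega>)))"
proof (rule conjI; rule impI; elim conjE)
  assume cl: "alg_clustering_state scC star loc iota p \<omega>" and p: "p > 2 * real CARD('d)"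
  have form: "(\<forall>A\<in>Oloc loc. \<forall>B\<in>Oloc loc. corr_term star iota \<omega> A B summable_on UNIV) \<and>
      alg_clustering_form scC star loc iota q \<omega> (omega_form star iota \<omega>)"
    if "real CARD('d) < q" "q < p - real CARD('d)" for q
    by (rule alg_clustering_form_omega_form[OF assms cl that])
  \<comment> \<open>Summability does not mention \<open>q\<close>, so one admissible exponent yields
    it; \<open>p > 2 * real CARD('d)\<close> makes the range nonempty.\<close>
  obtain q where "real CARD('d) < q" "q < p - real CARD('d)"
    using dense[of "real CARD('d)" "p - real CARD('d)"] p by auto
  from form[OF this] form
  show "(\<forall>A\<in>Oloc loc. \<forall>B\<in>Oloc loc. corr_term star iota \<omega> A B summable_on UNIV) \<and>
      (\<forall>q. real CARD('d) < q \<and> q < p - real CARD('d) \<longrightarrow>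
         alg_clustering_form scC star loc iota q \<omega> (omega_form star iota \<omega>))"
    by simp
next
  assume cl: "exp_clustering_state scC star loc iota \<alpha> \<omega>" and \<alpha>: "\<alpha> > 0"
  have form: "(\<forall>A\<in>Oloc loc. \<forall>B\<in>Oloc loc. corr_term star iota \<omega> A B summable_on UNIV) \<and>
      exp_clustering_form scC star loc iota \<beta> \<omega> (omega_form star iota \<omega>)"
    if "0 < \<beta>" "\<beta> < \<alpha> / 2" for \<beta>
    by (rule exp_clustering_form_omega_form[OF assms cl that])
  \<comment> \<open>Likewise, a sample rate in the admissible range provides the
    summability.\<close>
  have "0 < \<alpha> / 4" "\<alpha> / 4 < \<alpha> / 2" using \<alpha> by auto
  from form[OF this] form
  show "(\<forall>A\<in>Oloc loc. \<forall>B\<in>Oloc loc. corr_term star iota \<omega> A B summable_on UNIV) \<and>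
      (\<forall>\<beta>. 0 < \<beta> \<and> \<beta> < \<alpha> / 2 \<longrightarrow>
         exp_clustering_form scC star loc iota \<beta> \<omega> (omega_form star iota \<omega>))"
    by simp
qed

end
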